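(* Let $R\in\mathbb{R}$ and let $n\ge2$ be an integer. There exists a minimal $S^2$-type representation of $\mathcal{A}(R)$ of dimension $n$ if and only if $-1<R<\sec(\pi/n)$ (where for $n=2$ the upper bound $\sec(\pi/2)$ is read as $+\infty$). In this case the representation is unique (up to equivalence), and, with $\beta$ normalised so that $\beta':=\beta-\tfrac12\alpha$ satisfies $-2\pi<\beta'\le0$, its parameters $(\alpha,\beta)$ are given by $$\cos(\tfrac12n\alpha)+R\cos(\tfrac12\alpha)=0,\qquad 0<\alpha<2\pi/n,\qquad \beta'=-\tfrac12n\alpha.$$
   Context: For $R\in\mathbb{R}$, $\mathcal{A}(R)$ is the unital associative complex algebra generated by $\mathbf{x},\mathbf{y},\mathbf{z},\boldsymbol{\varepsilon},(1+\boldsymbol{\varepsilon}^2)^{-1}$, where $\boldsymbol{\varepsilon}$ is central and $(1+\boldsymbol{\varepsilon}^2)^{-1}$ is the inverse of $1+\boldsymbol{\varepsilon}^2$, subject to $[\mathbf{x},\mathbf{y}]=i\boldsymbol{\varepsilon}\mathbf{z}$, $[\mathbf{y},\mathbf{z}]=i\boldsymbol{\varepsilon}(\mathbf{w}\mathbf{x}+\mathbf{x}\mathbf{w})$, $[\mathbf{z},\mathbf{x}]=i\boldsymbol{\varepsilon}(\mathbf{w}\mathbf{y}+\mathbf{y}\mathbf{w})$, $\mathbf{z}^2+\mathbf{w}^2=1$, where $\mathbf{w}:=\mathbf{x}^2+\mathbf{y}^2-R$. It carries the conjugate-linear anti-multiplicative involution $\dagger$ fixing $\mathbf{x},\mathbf{y},\mathbf{z},\boldsymbol{\varepsilon}$.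 Put $\mathbf{u}:=\mathbf{w}+i\mathbf{z}$, $\mathbf{a}_\pm:=\mathbf{x}\pm i\mathbf{y}$. Representations considered: irreducible $\Psi:\mathcal{A}(R)\to\mathcal{L}(\mathcal{H},\mathcal{H})$ on an $n$-dimensional complex Hilbert space, with $\Psi(\mathbf{f}^\dagger)=\Psi(\mathbf{f})^\dagger$ for all $\mathbf f$, $\Psi(\boldsymbol{\varepsilon})=\varepsilon\,\mathrm{Id}$ for some real $\varepsilon>0$ (not fixed in advance), and $\Psi(\mathbf{u})$ having no multiple eigenvalues. Let $\alpha\in(0,\pi)$ be defined by $\tan(\tfrac12\alpha)=\varepsilon$. Such a $\Psi$ is an $S^2$-type representation with parameters $(R,n,\alpha,\beta)$, $\beta\in\mathbb{R}$, if there are an orthonormal basis $|\beta+m\alpha\rangle$, $m=0,\dots,n-1$, of $\mathcal{H}$ and constants $C_{\beta+m\alpha}\in\mathbb{C}$, $m=0,\dots,n$, with $|C_{\beta+m\alpha}|^2=\sec(\tfrac12\alpha)\cos(\beta-\tfrac12\alpha+m\alpha)+R$, $C_{\beta+m\alpha}\ne0$ for $1\le m\le n-1$, $C_\beta=C_{\beta+n\alpha}=0$, such that (writing $\mathbf{f}$ for $\Psi(\mathbf{f})$) $\mathbf{u}|\beta+m\alpha\rangle=e^{i(\beta+m\alpha)}|\beta+m\alpha\rangle$ for $0\le m\le n-1$; $\mathbf{a}_-|\beta+m\alpha\rangle=C_{\beta+m\alpha}|\beta+(m-1)\alpha\rangle$ for $1\le m\le n-1$; $\mathbf{a}_+|\beta+m\alpha\rangle=\overline{C_{\beta+(m+1)\alpha}}|\beta+(m+1)\alpha\rangle$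 for $0\le m\le n-2$; $\mathbf{a}_-|\beta\rangle=0$ and $\mathbf{a}_+|\beta+(n-1)\alpha\rangle=0$. Replacing $\beta$ by $\beta+2\pi j$, $j\in\mathbb{Z}$, does not change the representation, so one may normalise $-2\pi<\beta-\tfrac12\alpha\le0$. An $S^2$-type representation is minimal if $n\alpha<2\pi$. Equivalent means unitarily equivalent. *)

theory Defs
  imports "HOL-Analysis.Analysis" "HOL-Library.Poly_Mapping" "HOL-Algebra.QuotRing"
begin

section \<open>Complex inner product spaces\<close>

text \<open>The inner product is conjugate-linear in its first argument. Completeness is not
  required: the class is only used in finite dimension, where it is automatic.\<close>

class complex_inner = ab_group_add +
  fixes scaleC :: "complex \<Rightarrow> 'a \<Rightarrow> 'a"
    and cinner :: "'a \<Rightarrow> 'a \<Rightarrow> complex"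
  assumes scaleC_add_right: "scaleC a (x + y) = scaleC a x + scaleC a y"
    and scaleC_add_left: "scaleC (a + b) x = scaleC a x + scaleC b x"
    and scaleC_scaleC: "scaleC a (scaleC b x) = scaleC (a * b) x"
    and scaleC_one: "scaleC 1 x = x"
    and cinner_add_right: "cinner x (y + z) = cinner x y + cinner x z"
    and cinner_scaleC_right: "cinner x (scaleC a y) = a * cinner x y"
    and cinner_commute: "cinner x y = cnj (cinner y x)"
    and cinner_ge_zero: "0 \<le> Re (cinner x x)"
    and cinner_eq_zero: "cinner x x = 0 \<Longrightarrow> x = 0"

global_interpretation cvs: vector_space "scaleC :: complex \<Rightarrow> 'a \<Rightarrow> 'a::complex_inner"
  by unfold_locales
    (simp_all add: scaleC_add_right scaleC_add_left scaleC_scaleC scaleC_one)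

text \<open>Every positive dimension occurs: \<open>complex^'n\<close> has dimension \<open>CARD('n)\<close>.\<close>

instantiation complex :: complex_inner
begin
definition scaleC_complex :: "complex \<Rightarrow> complex \<Rightarrow> complex"
  where "scaleC_complex = (*)"
definition cinner_complex :: "complex \<Rightarrow> complex \<Rightarrow> complex"
  where "cinner_complex x y = cnj x * y"
instance
  by standard (auto simp: scaleC_complex_def cinner_complex_def algebra_simps)
end

instantiation vec :: (complex_inner, finite) complex_inner
begin
definition scaleC_vec :: "complex \<Rightarrow> 'a ^ 'b \<Rightarrow> 'a ^ 'b"
  where "scaleC_vec c x = (\<chi> i. scaleC c (x $ i))"
definition cinner_vec :: "'a ^ 'b \<Rightarrow> 'a ^ 'b \<Rightarrow> complex"
  where "cinner_vec x y = (\<Sum>i\<in>UNIV. cinner (x $ i) (y $ i))"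
instance
proof
  fix x y z :: "'a ^ 'b" and a b :: complex
  show "scaleC a (x + y) = scaleC a x + scaleC a y"
    "scaleC (a + b) x = scaleC a x + scaleC b x"
    "scaleC a (scaleC b x) = scaleC (a * b) x"
    "scaleC 1 x = x"
    by (simp_all add: scaleC_vec_def vec_eq_iff scaleC_add_right scaleC_add_left
        scaleC_scaleC scaleC_one)
  show "cinner x (y + z) = cinner x y + cinner x z"
    by (simp add: cinner_vec_def cinner_add_right sum.distrib)
  show "cinner x (scaleC a y) = a * cinner x y"
    by (simp add: cinner_vec_def scaleC_vec_def cinner_scaleC_right sum_distrib_left)
  show "cinner x y = cnj (cinner y x)"
    unfolding cinner_vec_def cnj_sum by (intro sum.cong refl cinner_commute)
  show "0 \<le> Re (cinner x x)"
    by (simp add: cinner_vec_def cinner_ge_zero sum_nonneg)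
  assume "cinner x x = 0"
  then have "(\<Sum>i\<in>UNIV. Re (cinner (x $ i) (x $ i))) = 0"
    unfolding cinner_vec_def by (metis Re_sum zero_complex.sel(1))
  then have "Re (cinner (x $ i) (x $ i)) = 0" for i
    by (subst (asm) sum_nonneg_eq_0_iff) (auto simp: cinner_ge_zero)
  moreover have "Im (cinner (x $ i) (x $ i)) = 0" for i
    using cinner_commute[of "x $ i" "x $ i"] by (simp add: complex_eq_iff)
  ultimately show "x = 0"
    by (simp add: vec_eq_iff cinner_eq_zero complex_eq_iff)
qed
end

lemma dim_complex_vec: "cvs.dim (UNIV :: (complex ^ 'n) set) = CARD('n)"
proof -
  have "(scaleC :: complex \<Rightarrow> complex ^ 'n \<Rightarrow> _) = (*s)"
    by (simp add: fun_eq_iff scaleC_vec_def scaleC_complex_def vector_scalar_mult_def)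
  then show ?thesis
    using vec_dim_card[where 'a = complex and 'n = 'n] by simp
qed

definition adjoint_pair :: "('h::complex_inner \<Rightarrow> 'h) \<Rightarrow> ('h \<Rightarrow> 'h) \<Rightarrow> bool"
  where "adjoint_pair A B \<longleftrightarrow> (\<forall>v w. cinner (A v) w = cinner v (B w))"

text \<open>The unital algebra \<open>L(H,H)\<close> of all linear operators on \<open>H\<close>, in the intended
  finite-dimensional case.\<close>

definition operators :: "('h::complex_inner \<Rightarrow> 'h) ring" where
  "operators = \<lparr>carrier = {A. Vector_Spaces.linear scaleC scaleC A},
     mult = (\<circ>), one = id, zero = (\<lambda>v. 0), add = (\<lambda>A B v. A v + B v)\<rparr>"

definition unitary_map :: "('h::complex_inner \<Rightarrow> 'k::complex_inner) \<Rightarrow> bool" where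
  "unitary_map T \<longleftrightarrow> Vector_Spaces.linear scaleC scaleC T \<and> surj T \<and>
     (\<forall>v w. cinner (T v) (T w) = cinner v w)"

definition orthonormal_basis :: "nat \<Rightarrow> (nat \<Rightarrow> 'h::complex_inner) \<Rightarrow> bool" where
  "orthonormal_basis n b \<longleftrightarrow>
     (\<forall>j<n. \<forall>k<n. cinner (b j) (b k) = (if j = k then 1 else 0)) \<and>
     cvs.span (b ` {..<n}) = UNIV"


section \<open>The algebra\<close>

text \<open>\<open>GInv\<close> is the inverse of \<open>1 + \<epsilon>\<^sup>2\<close>.\<close>

datatype gen = GX | GY | GZ | GEps | GInv

text \<open>Words form the free monoid (written additively), so the finitely supported functions
  \<open>word \<Rightarrow>\<^sub>0 complex\<close> with convolution product form the free unital complex algebra on the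
  generators.\<close>

datatype word = Word (letters: "gen list")

instantiation word :: monoid_add
begin
definition zero_word :: word where "0 = Word []"
definition plus_word :: "word \<Rightarrow> word \<Rightarrow> word" where "u + v = Word (letters u @ letters v)"
instance by standard (auto simp: zero_word_def plus_word_def)
end

type_synonym free_alg = "word \<Rightarrow>\<^sub>0 complex"

definition var :: "gen \<Rightarrow> free_alg" where "var g = Poly_Mapping.single (Word [g]) 1"
definition const :: "complex \<Rightarrow> free_alg" where "const c = Poly_Mapping.single 0 c"

definition free_ring :: "free_alg ring" where
  "free_ring = \<lparr>carrier = UNIV, mult = (*), one = 1, zero = 0, add = (+)\<rparr>"

abbreviation (input) fX where "fX \<equiv> var GX"
abbreviation (input) fY where "fY \<equiv> var GY"
abbreviation (input) fZ where "fZ \<equiv> var GZ"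
abbreviation (input) fEps where "fEps \<equiv> var GEps"
abbreviation (input) fInv where "fInv \<equiv> var GInv"

definition fW :: "real \<Rightarrow> free_alg"
  where "fW R = fX * fX + fY * fY - const (of_real R)"

definition relators :: "real \<Rightarrow> free_alg set" where
  "relators R =
     {fEps * var g - var g * fEps | g. True} \<union>
     {(1 + fEps * fEps) * fInv - 1,
      fInv * (1 + fEps * fEps) - 1,
      (fX * fY - fY * fX) - const \<i> * fEps * fZ,
      (fY * fZ - fZ * fY) - const \<i> * fEps * (fW R * fX + fX * fW R),
      (fZ * fX - fX * fZ) - const \<i> * fEps * (fW R * fY + fY * fW R),
      (fZ * fZ + fW R * fW R) - 1}"

definition rel_ideal :: "real \<Rightarrow> free_alg set"
  where "rel_ideal R = Idl\<^bsub>free_ring\<^esub> (relators R)"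

definition alg :: "real \<Rightarrow> free_alg set ring"
  where "alg R = free_ring Quot rel_ideal R"

definition cls :: "real \<Rightarrow> free_alg \<Rightarrow> free_alg set"
  where "cls R p = rel_ideal R +>\<^bsub>free_ring\<^esub> p"

definition scal :: "real \<Rightarrow> complex \<Rightarrow> free_alg set \<Rightarrow> free_alg set"
  where "scal R c f = cls R (const c) \<otimes>\<^bsub>alg R\<^esub> f"

text \<open>The conjugate-linear anti-multiplicative involution of the free algebra that fixes the
  generators: conjugate the coefficients and reverse the words.\<close>

definition rev_word :: "word \<Rightarrow> word" where "rev_word u = Word (rev (letters u))"

definition star :: "free_alg \<Rightarrow> free_alg"
  where "star p = Poly_Mapping.map_key rev_word (Poly_Mapping.map cnj p)"

text \<open>The involution of the quotient acts on a coset elementwise; see \<open>dagger_cls\<close> below.\<close>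

definition dagger :: "free_alg set \<Rightarrow> free_alg set" where "dagger f = star ` f"

definition elt_eps where "elt_eps R = cls R fEps"
definition elt_u where "elt_u R = cls R (fW R + const \<i> * fZ)"
definition elt_a_plus where "elt_a_plus R = cls R (fX + const \<i> * fY)"
definition elt_a_minus where "elt_a_minus R = cls R (fX - const \<i> * fY)"

lemma inj_rev_word: "inj rev_word"
  by (auto simp: inj_def rev_word_def intro: word.expand)

lemma rev_word_rev_word [simp]: "rev_word (rev_word u) = u"
  by (simp add: rev_word_def)

lemma lookup_star: "Poly_Mapping.lookup (star p) u = cnj (Poly_Mapping.lookup p (rev_word u))"
  by (simp add: star_def Poly_Mapping.map_key.rep_eq[OF inj_rev_word] Poly_Mapping.map.rep_eq
      when_def)

lemma star_star [simp]: "star (star p) = p"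
  by (rule poly_mapping_eqI) (simp add: lookup_star)

lemma star_add: "star (p + q) = star p + star q"
  by (rule poly_mapping_eqI) (simp add: lookup_star lookup_add)

lemma star_single: "star (Poly_Mapping.single u c) = Poly_Mapping.single (rev_word u) (cnj c)"
  by (rule poly_mapping_eqI) (auto simp: lookup_star lookup_single when_def)

lemma star_zero: "star 0 = 0"
  by (rule poly_mapping_eqI) (simp add: lookup_star)

lemma star_minus: "star (p - q) = star p - star q"
  by (rule poly_mapping_eqI) (simp add: lookup_star lookup_minus)


lemma free_alg_induct [case_names zero monomial add]:
  fixes p :: free_alg
  assumes "P 0" "\<And>u c. P (Poly_Mapping.single u c)" "\<And>p q. P p \<Longrightarrow> P q \<Longrightarrow> P (p + q)"
  shows "P p"
proof (induction p rule: update_induct)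
  case (update f a b)
  then have "Poly_Mapping.update a b f = f + Poly_Mapping.single a b"
    by (intro poly_mapping_eqI)
      (auto simp: lookup_update lookup_add lookup_single when_def in_keys_iff)
  then show ?case using update assms by simp
qed (rule assms)

lemma star_mult: "star (p * q) = star q * star p"
proof (induction p rule: free_alg_induct)
  case (monomial u c)
  show ?case
    by (induction q rule: free_alg_induct)
      (simp_all add: star_single mult_single star_add distrib_left distrib_right plus_word_def
        rev_word_def star_zero mult.commute)
qed (simp_all add: star_add distrib_left distrib_right star_zero)

lemma const_central: "const c * p = p * const c"
  by (induction p rule: free_alg_induct)
    (simp_all add: const_def mult_single distrib_left distrib_right mult.commute)

lemma star_const: "star (const c) = const (cnj c)"
  by (simp add: const_def star_single rev_word_def zero_word_def)

lemma star_var: "star (var g) = var g"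
  by (simp add: var_def star_single rev_word_def)

lemma star_one: "star 1 = 1"
  by (metis complex_cnj_one const_def single_one star_const)

lemma star_fW: "star (fW R) = fW R"
  by (simp add: fW_def star_minus star_add star_mult star_var star_const)

lemma ring_free_ring: "ring free_ring"
  by unfold_locales
    (auto simp: free_ring_def Units_def algebra_simps intro: exI[of _ "- x" for x])

lemma ideal_rel_ideal: "ideal (rel_ideal R) free_ring"
  unfolding rel_ideal_def
  by (rule ring.genideal_ideal[OF ring_free_ring]) (simp add: free_ring_def)

lemma rel_ideal_add: "p \<in> rel_ideal R \<Longrightarrow> q \<in> rel_ideal R \<Longrightarrow> p + q \<in> rel_ideal R"
  using additive_subgroup.a_closed[OF ideal.axioms(1)[OF ideal_rel_ideal]]
  by (auto simp: free_ring_def)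

lemma rel_ideal_zero: "0 \<in> rel_ideal R"
  using additive_subgroup.zero_closed[OF ideal.axioms(1)[OF ideal_rel_ideal]]
  by (auto simp: free_ring_def)

lemma rel_ideal_mult_left: "p \<in> rel_ideal R \<Longrightarrow> q * p \<in> rel_ideal R"
  using ideal.I_l_closed[OF ideal_rel_ideal, of p R q] by (simp add: free_ring_def)

lemma rel_ideal_mult_right: "p \<in> rel_ideal R \<Longrightarrow> p * q \<in> rel_ideal R"
  using ideal.I_r_closed[OF ideal_rel_ideal, of p R q] by (simp add: free_ring_def)

lemma rel_ideal_uminus: "p \<in> rel_ideal R \<Longrightarrow> - p \<in> rel_ideal R"
  using rel_ideal_mult_left[of p R "- 1"] by simp

lemma rel_ideal_minus: "p \<in> rel_ideal R \<Longrightarrow> q \<in> rel_ideal R \<Longrightarrow> p - q \<in> rel_ideal R"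
  using rel_ideal_add[of p R "- q"] rel_ideal_uminus by simp

lemma relators_in_rel_ideal: "p \<in> relators R \<Longrightarrow> p \<in> rel_ideal R"
  using ring.genideal_self[OF ring_free_ring, of "relators R"]
  by (auto simp: rel_ideal_def free_ring_def)

lemma rel_ideal_minimal:
  assumes "relators R \<subseteq> J" and "0 \<in> J"
    and "\<And>p q. p \<in> J \<Longrightarrow> q \<in> J \<Longrightarrow> p + q \<in> J"
    and "\<And>p q. p \<in> J \<Longrightarrow> q * p \<in> J" and "\<And>p q. p \<in> J \<Longrightarrow> p * q \<in> J"
  shows "rel_ideal R \<subseteq> J"
proof -
  interpret F: ring free_ring by (rule ring_free_ring)
  have uminus: "- p \<in> J" if "p \<in> J" for p
    using assms(4)[OF that, of "- 1"] by simp
  have a_inv: "\<ominus>\<^bsub>free_ring\<^esub> p = - p" for p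
    by (rule F.minus_equality) (simp_all add: free_ring_def)
  have "subgroup J (add_monoid free_ring)"
    by (rule F.add.subgroupI)
      (use assms uminus a_inv in \<open>auto simp: free_ring_def a_inv_def\<close>)
  then have "ideal J free_ring"
    by (rule idealI[OF ring_free_ring]) (use assms in \<open>auto simp: free_ring_def\<close>)
  then show ?thesis
    unfolding rel_ideal_def by (rule F.genideal_minimal) (use assms in auto)
qed

lemma eps_central: "fEps * p - p * fEps \<in> rel_ideal R"
proof (induction p rule: free_alg_induct)
  case (monomial u c)
  have words: "fEps * Poly_Mapping.single (Word l) 1 - Poly_Mapping.single (Word l) 1 * fEps
      \<in> rel_ideal R" for l
  proof (induction l)
    case Nil
    have "Poly_Mapping.single (Word []) 1 = (1 :: free_alg)"
      by (metis single_one zero_word_def)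
    then show ?case by (simp add: rel_ideal_zero)
  next
    case (Cons g l)
    let ?l = "Poly_Mapping.single (Word l) 1 :: free_alg"
    have eq: "Poly_Mapping.single (Word (g # l)) 1 = var g * ?l"
      by (simp add: var_def mult_single plus_word_def)
    have "fEps * (var g * ?l) - var g * ?l * fEps =
        (fEps * var g - var g * fEps) * ?l + var g * (fEps * ?l - ?l * fEps)"
      by (simp add: algebra_simps)
    moreover have "fEps * var g - var g * fEps \<in> rel_ideal R"
      by (rule relators_in_rel_ideal) (auto simp: relators_def)
    ultimately show ?case
      using Cons by (simp add: eq rel_ideal_add rel_ideal_mult_left rel_ideal_mult_right)
  qed
  have eq: "Poly_Mapping.single u c = const c * Poly_Mapping.single (Word (letters u)) 1"
    by (simp add: const_def mult_single)
  show ?case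
    using rel_ideal_mult_left[OF words[of "letters u"], of "const c"]
    by (simp add: eq right_diff_distrib flip: mult.assoc const_central)
next
  case (add p q)
  have "fEps * (p + q) - (p + q) * fEps =
      (fEps * p - p * fEps) + (fEps * q - q * fEps)"
    by (simp add: algebra_simps)
  then show ?case using add by (simp add: rel_ideal_add)
qed (simp add: rel_ideal_zero)

lemma star_rel_ideal: "p \<in> rel_ideal R \<Longrightarrow> star p \<in> rel_ideal R"
proof -
  let ?J = "{p. star p \<in> rel_ideal R}"
  note star_simps = star_minus star_add star_mult star_var star_const star_one star_fW
  have comm: "star (A - const \<i> * fEps * q) \<in> rel_ideal R"
    if "A - const \<i> * fEps * q \<in> rel_ideal R" "star A = - A" "star q = q" for A q
  proof -
    have minus_const: "const (- \<i>) = - const \<i>"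
      by (simp add: const_def single_uminus)
    have "star (A - const \<i> * fEps * q) = - A - q * (fEps * const (- \<i>))"
      using that by (simp add: star_simps)
    also have "q * (fEps * const (- \<i>)) = const (- \<i>) * (q * fEps)"
      by (simp only: mult.assoc const_central)
    also have "- A - const (- \<i>) * (q * fEps) =
        - (A - const \<i> * fEps * q) - const \<i> * (fEps * q - q * fEps)"
      by (simp add: minus_const right_diff_distrib mult.assoc)
    finally show ?thesis
      by (simp only: rel_ideal_minus rel_ideal_uminus rel_ideal_mult_left eps_central that(1))
  qed
  have rel: "r \<in> rel_ideal R" if "r \<in> relators R" for r
    using that by (rule relators_in_rel_ideal)
  have "star r \<in> rel_ideal R" if "r \<in> relators R" for r
    using that unfolding relators_def
  proof (elim UnE insertE emptyE CollectE exE conjE)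
    fix g assume "r = fEps * var g - var g * fEps"
    then have "star r = - r" by (simp add: star_simps)
    then show ?thesis using rel[OF that] by (simp add: rel_ideal_uminus)
  next
    assume "r = (1 + fEps * fEps) * fInv - 1"
    then have "star r = fInv * (1 + fEps * fEps) - 1" by (simp add: star_simps)
    then show ?thesis by (simp add: rel relators_def)
  next
    assume "r = fInv * (1 + fEps * fEps) - 1"
    then have "star r = (1 + fEps * fEps) * fInv - 1" by (simp add: star_simps)
    then show ?thesis by (simp add: rel relators_def)
  next
    assume "r = fZ * fZ + fW R * fW R - 1"
    then have "star r = r" by (simp add: star_simps)
    then show ?thesis using rel[OF that] by simp
  next
    assume r: "r = fX * fY - fY * fX - const \<i> * fEps * fZ"
    show ?thesis using rel[OF that] unfolding r by (rule comm) (simp_all add: star_simps)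
  next
    assume r: "r = fY * fZ - fZ * fY - const \<i> * fEps * (fW R * fX + fX * fW R)"
    show ?thesis using rel[OF that] unfolding r by (rule comm) (simp_all add: star_simps)
  next
    assume r: "r = fZ * fX - fX * fZ - const \<i> * fEps * (fW R * fY + fY * fW R)"
    show ?thesis using rel[OF that] unfolding r by (rule comm) (simp_all add: star_simps)
  qed
  then have "rel_ideal R \<subseteq> ?J"
    by (intro rel_ideal_minimal)
      (auto simp: star_zero star_add star_mult rel_ideal_zero rel_ideal_add
        rel_ideal_mult_left rel_ideal_mult_right)
  then show "p \<in> rel_ideal R \<Longrightarrow> star p \<in> rel_ideal R" by blast
qed

lemma cls_alt: "cls R p = {q + p | q. q \<in> rel_ideal R}"
  by (auto simp: cls_def a_r_coset_def' free_ring_def)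

lemma dagger_cls: "dagger (cls R p) = cls R (star p)"
proof
  show "dagger (cls R p) \<subseteq> cls R (star p)"
    by (auto simp: dagger_def cls_alt star_add intro: star_rel_ideal)
  show "cls R (star p) \<subseteq> dagger (cls R p)"
  proof
    fix f assume "f \<in> cls R (star p)"
    then obtain q where "q \<in> rel_ideal R" "f = q + star p" by (auto simp: cls_alt)
    then have "f = star (star q + p)" "star q + p \<in> cls R p"
      by (auto simp: star_add cls_alt intro: star_rel_ideal)
    then show "f \<in> dagger (cls R p)" by (auto simp: dagger_def)
  qed
qed


section \<open>Representations\<close>

definition invariant_subspace ::
  "real \<Rightarrow> (free_alg set \<Rightarrow> 'h \<Rightarrow> 'h) \<Rightarrow> 'h::complex_inner set \<Rightarrow> bool"
  where "invariant_subspace R \<Psi> S \<longleftrightarrow>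
    cvs.subspace S \<and> (\<forall>f\<in>carrier (alg R). \<Psi> f ` S \<subseteq> S)"

text \<open>Only the values of \<open>\<Psi>\<close> on \<open>carrier (alg R)\<close> matter. The image of \<open>u\<close> is normal
  (in fact unitary), so its eigenvalues are simple iff the eigenspaces have dimension at
  most 1.\<close>

definition admissible_rep ::
  "real \<Rightarrow> (free_alg set \<Rightarrow> 'h::complex_inner \<Rightarrow> 'h) \<Rightarrow> real \<Rightarrow> bool" where
  "admissible_rep R \<Psi> \<epsilon> \<longleftrightarrow>
     \<Psi> \<in> ring_hom (alg R) operators \<and>
     (\<forall>c. \<forall>f\<in>carrier (alg R). \<forall>v. \<Psi> (scal R c f) v = scaleC c (\<Psi> f v)) \<and>
     (UNIV :: 'h set) \<noteq> {0} \<and>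
     (\<forall>S. invariant_subspace R \<Psi> S \<longrightarrow> S = {0} \<or> S = UNIV) \<and>
     (\<forall>f\<in>carrier (alg R). adjoint_pair (\<Psi> f) (\<Psi> (dagger f))) \<and>
     0 < \<epsilon> \<and> (\<forall>v. \<Psi> (elt_eps R) v = scaleC (of_real \<epsilon>) v) \<and>
     (\<forall>\<mu>. cvs.dim {v. \<Psi> (elt_u R) v = scaleC \<mu> v} \<le> 1)"

text \<open>\<open>b m\<close> is the basis vector \<open>|\<beta> + m\<alpha>\<rangle>\<close> and \<open>C m\<close> is the constant \<open>C\<close> with index
  \<open>\<beta> + m\<alpha>\<close>; the secant of \<open>\<alpha>/2\<close> is written as \<open>1 / cos (\<alpha>/2)\<close>.\<close>

definition S2_type ::
  "real \<Rightarrow> nat \<Rightarrow> real \<Rightarrow> real \<Rightarrow> (free_alg set \<Rightarrow> 'h::complex_inner \<Rightarrow> 'h) \<Rightarrow> bool"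
  where
  "S2_type R n \<alpha> \<beta> \<Psi> \<longleftrightarrow>
     cvs.dim (UNIV :: 'h set) = n \<and>
     0 < \<alpha> \<and> \<alpha> < pi \<and> admissible_rep R \<Psi> (tan (\<alpha> / 2)) \<and>
     (\<exists>(b :: nat \<Rightarrow> 'h) (C :: nat \<Rightarrow> complex).
        orthonormal_basis n b \<and>
        (\<forall>m\<le>n. (cmod (C m))\<^sup>2 =
           (1 / cos (\<alpha> / 2)) * cos (\<beta> - \<alpha> / 2 + real m * \<alpha>) + R) \<and>
        (\<forall>m. 1 \<le> m \<and> m < n \<longrightarrow> C m \<noteq> 0) \<and> C 0 = 0 \<and> C n = 0 \<and>
        (\<forall>m<n. \<Psi> (elt_u R) (b m) = scaleC (cis (\<beta> + real m * \<alpha>)) (b m)) \<and>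
        (\<forall>m. 1 \<le> m \<and> m < n \<longrightarrow>
           \<Psi> (elt_a_minus R) (b m) = scaleC (C m) (b (m - 1))) \<and>
        (\<forall>m. m + 1 < n \<longrightarrow>
           \<Psi> (elt_a_plus R) (b m) = scaleC (cnj (C (m + 1))) (b (m + 1))) \<and>
        \<Psi> (elt_a_minus R) (b 0) = 0 \<and> \<Psi> (elt_a_plus R) (b (n - 1)) = 0)"

definition minimal_S2_rep ::
  "real \<Rightarrow> nat \<Rightarrow> (free_alg set \<Rightarrow> 'h::complex_inner \<Rightarrow> 'h) \<Rightarrow> bool" where
  "minimal_S2_rep R n \<Psi> \<longleftrightarrow> (\<exists>\<alpha> \<beta>. S2_type R n \<alpha> \<beta> \<Psi> \<and> real n * \<alpha> < 2 * pi)"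

definition unitarily_equivalent ::
  "real \<Rightarrow> (free_alg set \<Rightarrow> 'h::complex_inner \<Rightarrow> 'h) \<Rightarrow>
    (free_alg set \<Rightarrow> 'k::complex_inner \<Rightarrow> 'k) \<Rightarrow> bool" where
  "unitarily_equivalent R \<Psi> \<Phi> \<longleftrightarrow>
     (\<exists>T :: 'h \<Rightarrow> 'k. unitary_map T \<and>
        (\<forall>f\<in>carrier (alg R). \<forall>v. T (\<Psi> f v) = \<Phi> f (T v)))"

end

theory Submission
  imports Defs
begin

text \<open>The vanishing of the ladder coefficients at both ends forces
  \<open>cos \<beta>' = cos (\<beta>' + n\<alpha>) = - R cos (\<alpha>/2)\<close>; since \<open>0 < n\<alpha> < 2\<pi>\<close>, this leaves
  \<open>\<beta>' = - n\<alpha>/2\<close> or \<open>\<beta>' = - n\<alpha>/2 - \<pi>\<close>, and positivity of the interior coefficients excludes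
  the latter. Writing \<open>t = \<alpha>/2\<close>, the remaining equation is \<open>R = - cos (n t) / cos t\<close>, whose
  right-hand side increases strictly on \<open>(0, \<pi>/n)\<close> from \<open>-1\<close> to \<open>sec (\<pi>/n)\<close>, so that \<open>\<alpha>\<close> is
  determined by \<open>R\<close>. Representations with equal parameters differ only in the phases of the
  ladder coefficients, which a diagonal unitary removes. Conversely, every solution \<open>\<alpha>\<close> gives
  ladder operators satisfying the defining relations.\<close>

text \<open>The secant and the tangent are what make the ladder close. Seen from a basis vector with
  angle \<theta>, the two neighbouring coefficients have their squared norms evaluated at \<theta> -
  \<alpha>/2 and \<theta> + \<alpha>/2. Half the sum is cos \<theta> + R, which makes x^2 + y^2 - R
  act as w; the difference is 2 tan(\<alpha>/2) sin \<theta>, which is the relation for [x,y]. The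
  other two commutators only compare sin and cos at adjacent angles. Since C vanishes at both ends,
  cutting the ladder off after n vectors does not disturb these identities. The space is an
  arbitrary type of dimension n, so an orthonormal basis has to be constructed before a ladder can
  be placed on it. Conversely, the angle of a given representation is read off from the scalar
  tan(\<alpha>/2) by which \<epsilon> acts. Vector identities are checked on basis vectors or after
  pairing with a test vector.\<close>

abbreviation clinear :: "('h::complex_inner \<Rightarrow> 'k::complex_inner) \<Rightarrow> bool"
  where "clinear \<equiv> Vector_Spaces.linear scaleC scaleC"

section \<open>Linear algebra in complex inner product spaces\<close>

lemma clinear_iff:
  "clinear A \<longleftrightarrow> (\<forall>v w. A (v + w) = A v + A w) \<and> (\<forall>c v. A (scaleC c v) = scaleC c (A v))"
  by (simp add: Vector_Spaces.linear_iff cvs.vector_space_axioms)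

lemma clinear_simps:
  assumes "clinear A"
  shows "A (v + w) = A v + A w" "A (scaleC c v) = scaleC c (A v)" "A 0 = 0"
    "A (v - w) = A v - A w" "A (\<Sum>i\<in>I. f i) = (\<Sum>i\<in>I. A (f i))"
proof -
  interpret Vector_Spaces.linear scaleC scaleC A by fact
  show "A (v + w) = A v + A w" "A (scaleC c v) = scaleC c (A v)" "A 0 = 0"
    "A (v - w) = A v - A w" "A (\<Sum>i\<in>I. f i) = (\<Sum>i\<in>I. A (f i))"
    by (simp_all add: add scale zero diff sum)
qed

lemma clinear_cinner_right: "clinear (cinner v)"
  unfolding clinear_iff by (simp add: cinner_add_right cinner_scaleC_right scaleC_complex_def)

lemma cinner_zero_right: "cinner v 0 = 0"
  and cinner_diff_right: "cinner v (w - w') = cinner v w - cinner v w'"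
  and cinner_sum_right: "cinner v (\<Sum>i\<in>I. f i) = (\<Sum>i\<in>I. cinner v (f i))"
  by (simp_all only: clinear_simps(3-5)[OF clinear_cinner_right])

lemma cinner_add_left: "cinner (v + v') w = cinner v w + cinner v' w"
  by (metis cinner_add_right cinner_commute complex_cnj_add)

lemma cinner_scaleC_left: "cinner (scaleC a v) w = cnj a * cinner v w"
  by (metis cinner_commute cinner_scaleC_right complex_cnj_mult)

lemma cinner_zero_left: "cinner 0 v = 0"
  by (metis cinner_commute cinner_zero_right complex_cnj_zero)

lemma cinner_diff_left: "cinner (v - v') w = cinner v w - cinner v' w"
  by (metis cinner_commute cinner_diff_right complex_cnj_diff)

text \<open>Positive definiteness, applied to \<open>v - w\<close>. Pairing with a test vector
  replaces an identity of vectors by one of complex numbers, where ring and field arithmetic is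
  available.\<close>

lemma cinner_extensional: "v = w" if "\<And>t. cinner t v = cinner t w"
  using that[of "v - w"] by (metis cinner_diff_right cinner_eq_zero right_minus_eq)

lemma cinner_self_real: "cinner v v = of_real (Re (cinner v v))"
  using cinner_commute[of v v] by (simp add: complex_eq_iff)

lemma orthonormal_independent:
  fixes n :: nat
  assumes "\<And>j k. j < n \<Longrightarrow> k < n \<Longrightarrow> cinner (b j) (b k) = (if j = k then 1 else 0)"
  shows "cvs.independent (b ` {..<n})" and "inj_on b {..<n}"
proof -
  show inj: "inj_on b {..<n}"
    using assms by (intro inj_onI) (metis lessThan_iff zero_neq_one)
  show "cvs.independent (b ` {..<n})"
  proof (rule cvs.independent_if_scalars_zero)
    fix f v assume eq: "(\<Sum>x\<in>b ` {..<n}. scaleC (f x) x) = 0" and "v \<in> b ` {..<n}"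
    then obtain k where k: "k < n" "v = b k" by auto
    have "0 = cinner (b k) (\<Sum>j<n. scaleC (f (b j)) (b j))"
      using eq by (simp add: sum.reindex[OF inj] cinner_zero_right)
    also have "\<dots> = (\<Sum>j<n. if j = k then f (b j) else 0)"
      unfolding cinner_sum_right
      by (intro sum.cong) (use k assms in \<open>auto simp: cinner_scaleC_right\<close>)
    also have "\<dots> = f v" using k by (simp add: sum.delta)
    finally show "f v = 0" by simp
  qed simp
qed

text \<open>One Gram-Schmidt step: a vector outside the span, minus its orthogonal projection
  \<open>p\<close>, is nonzero and orthogonal to the family, and can be normalised.\<close>

lemma orthonormal_extend:
  fixes n :: nat
  assumes "\<And>j k. j < n \<Longrightarrow> k < n \<Longrightarrow> cinner (b j) (b k) = (if j = k then 1 else 0)"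
    and "cvs.span (b ` {..<n}) \<noteq> UNIV"
  obtains e where "cinner e e = 1" "\<And>j. j < n \<Longrightarrow> cinner (b j) e = 0"
proof -
  obtain v where v: "v \<notin> cvs.span (b ` {..<n})" using assms(2) by auto
  define p where "p = (\<Sum>j<n. scaleC (cinner (b j) v) (b j))"
  define w where "w = v - p"
  have "p \<in> cvs.span (b ` {..<n})"
    unfolding p_def by (auto intro!: cvs.span_sum cvs.span_scale intro: cvs.span_base)
  then have "w \<noteq> 0" using v by (auto simp: w_def)
  have orth: "cinner (b k) w = 0" if "k < n" for k
  proof -
    have "cinner (b k) p = (\<Sum>j<n. if j = k then cinner (b j) v else 0)"
      unfolding p_def cinner_sum_right
      by (intro sum.cong) (use that assms in \<open>auto simp: cinner_scaleC_right\<close>)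
    then show ?thesis using that by (simp add: sum.delta w_def cinner_diff_right)
  qed
  define r where "r = Re (cinner w w)"
  have r: "cinner w w = of_real r" using cinner_self_real by (simp add: r_def)
  moreover have "r \<noteq> 0" using r \<open>w \<noteq> 0\<close> cinner_eq_zero by force
  ultimately have "r > 0" using cinner_ge_zero[of w] by (simp add: r_def)
  let ?e = "scaleC (of_real (1 / sqrt r)) w"
  have "cinner ?e ?e = of_real (1 / sqrt r * (1 / sqrt r) * r)"
    by (simp only: cinner_scaleC_left cinner_scaleC_right r complex_cnj_complex_of_real of_real_mult mult.assoc)
  also have "1 / sqrt r * (1 / sqrt r) * r = 1" using \<open>r > 0\<close> by (simp add: field_simps)
  also have "complex_of_real 1 = 1" by simp
  finally have "cinner ?e ?e = 1" .
  with that[of ?e] show ?thesis using orth by (simp add: cinner_scaleC_right)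
qed

text \<open>Fewer than n vectors cannot span, so an orthonormal family can be extended up to length
  n. It then spans, because one more orthonormal vector would give n + 1 independent vectors in the
  span of the n-element set \<open>B\<close>.\<close>

lemma orthonormal_basis_exists:
  assumes "cvs.dim (UNIV :: 'h::complex_inner set) = n" and "0 < n"
  obtains b :: "nat \<Rightarrow> 'h::complex_inner" where "orthonormal_basis n b"
proof -
  obtain B :: "'h set" where B: "card B = n" "UNIV \<subseteq> cvs.span B"
    using cvs.basis_exists[of UNIV] assms(1) by metis
  \<comment> \<open>Infinite sets have cardinality 0, so n > 0 is what makes \<open>B\<close>
    finite.\<close>
  then have finB: "finite B" using assms(2) card_gt_0_iff by blast
  have "\<exists>b :: nat \<Rightarrow> 'h. \<forall>j<m. \<forall>k<m. cinner (b j) (b k) = (if j = k then 1 else 0)"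
    if "m \<le> n" for m
    using that
  proof (induction m)
    case (Suc m)
    then obtain b :: "nat \<Rightarrow> 'h"
      where b: "\<And>j k. j < m \<Longrightarrow> k < m \<Longrightarrow> cinner (b j) (b k) = (if j = k then 1 else 0)"
      by fastforce
    have "cvs.span (b ` {..<m}) \<noteq> UNIV"
      using cvs.dim_le_card[of UNIV "b ` {..<m}"] card_image_le[of "{..<m}" b] Suc.prems assms(1)
      by auto
    with orthonormal_extend[OF b]
    obtain e where e: "cinner e e = 1" "\<And>j. j < m \<Longrightarrow> cinner (b j) e = 0"
      by metis
    then have "cinner e (b j) = 0" if "j < m" for j
      using that by (metis cinner_commute complex_cnj_zero)
    with e b have "\<forall>j<Suc m. \<forall>k<Suc m.
        cinner ((b(m := e)) j) ((b(m := e)) k) = (if j = k then 1 else 0)"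
      by (auto simp: less_Suc_eq)
    then show ?case by blast
  qed auto
  then obtain b :: "nat \<Rightarrow> 'h"
    where b: "\<And>j k. j < n \<Longrightarrow> k < n \<Longrightarrow> cinner (b j) (b k) = (if j = k then 1 else 0)"
    by fastforce
  have "cvs.span (b ` {..<n}) = UNIV"
  proof (rule ccontr)
    assume "cvs.span (b ` {..<n}) \<noteq> UNIV"
    with orthonormal_extend[OF b]
    obtain e where e: "cinner e e = 1" "\<And>j. j < n \<Longrightarrow> cinner (b j) e = 0"
      by metis
    then have "cinner e (b j) = 0" if "j < n" for j
      using that by (metis cinner_commute complex_cnj_zero)
    with e b have "\<And>j k. j < Suc n \<Longrightarrow> k < Suc n \<Longrightarrow>
        cinner ((b(n := e)) j) ((b(n := e)) k) = (if j = k then 1 else 0)"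
      by (auto simp: less_Suc_eq)
    note orthonormal_independent[of "Suc n", OF this]
    then have "Suc n \<le> card B"
      using cvs.independent_span_bound[OF finB, of "(b(n := e)) ` {..<Suc n}"] B(2)
      by (simp only: card_image) auto
    then show False using B by simp
  qed
  with b have "orthonormal_basis n b" by (simp add: orthonormal_basis_def)
  then show ?thesis by (rule that)
qed

lemma orthonormal_basis_cinner:
  "orthonormal_basis n b \<Longrightarrow> j < n \<Longrightarrow> k < n \<Longrightarrow>
     cinner (b j) (b k) = (if j = k then 1 else 0)"
  by (simp add: orthonormal_basis_def)

lemma orthonormal_basis_nonzero: "orthonormal_basis n b \<Longrightarrow> j < n \<Longrightarrow> b j \<noteq> 0"
  using orthonormal_basis_cinner[of n b j j] by (auto simp: cinner_zero_left)

lemma clinear_eq_on_basis: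
  assumes "orthonormal_basis n b" "clinear A" "clinear B"
    and "\<And>j. j < n \<Longrightarrow> A (b j) = B (b j)"
  shows "A v = B v"
proof -
  have "v \<in> cvs.span (b ` {..<n})" using assms(1) by (simp add: orthonormal_basis_def)
  then show ?thesis
  proof (induction rule: cvs.span_induct)
    case base
    show ?case
      by (rule cvs.subspaceI) (simp_all add: clinear_simps assms(2,3))
  next
    case (step x)
    then show ?case using assms(4) by auto
  qed
qed

lemma eqI_coordinates:
  assumes "orthonormal_basis n b" "\<And>j. j < n \<Longrightarrow> cinner (b j) v = cinner (b j) w"
  shows "v = w"
proof (rule cinner_extensional)
  fix t
  have "cinner v t = cinner w t"
  proof (rule clinear_eq_on_basis[OF assms(1) clinear_cinner_right clinear_cinner_right])
    show "cinner v (b j) = cinner w (b j)" if "j < n" for j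
      using assms(2)[OF that] by (metis cinner_commute)
  qed
  then show "cinner t v = cinner t w" by (metis cinner_commute)
qed

section \<open>Linear maps prescribed on an orthonormal basis\<close>

definition basis_map ::
  "nat \<Rightarrow> (nat \<Rightarrow> 'h::complex_inner) \<Rightarrow> (nat \<Rightarrow> 'k::complex_inner) \<Rightarrow> 'h \<Rightarrow> 'k"
  where "basis_map n b g v = (\<Sum>j<n. scaleC (cinner (b j) v) (g j))"

lemma clinear_basis_map: "clinear (basis_map n b g)"
  unfolding clinear_iff basis_map_def
  by (simp add: cinner_add_right cinner_scaleC_right scaleC_add_left sum.distrib
      cvs.scale_sum_right scaleC_scaleC)

lemma basis_map_basis:
  assumes "orthonormal_basis n b" "k < n"
  shows "basis_map n b g (b k) = g k"
proof -
  have "basis_map n b g (b k) = (\<Sum>j<n. if j = k then g j else 0)"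
    unfolding basis_map_def
    by (intro sum.cong)
      (use assms in \<open>auto simp: orthonormal_basis_cinner scaleC_one cvs.scale_zero_left\<close>)
  then show ?thesis using assms(2) by simp
qed

lemma orthonormal_expansion:
  assumes "orthonormal_basis n b"
  shows "v = (\<Sum>j<n. scaleC (cinner (b j) v) (b j))"
proof -
  have "id v = basis_map n b b v"
    by (rule clinear_eq_on_basis[OF assms cvs.linear_id clinear_basis_map])
      (simp add: basis_map_basis[OF assms])
  then show ?thesis by (simp add: basis_map_def)
qed

lemma adjoint_pair_on_basis:
  assumes "orthonormal_basis n b" "clinear A" "clinear B"
    and "\<And>j k. j < n \<Longrightarrow> k < n \<Longrightarrow> cinner (A (b j)) (b k) = cinner (b j) (B (b k))"
  shows "adjoint_pair A B"
  unfolding adjoint_pair_def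
proof (intro allI)
  fix v w
  have 1: "cinner (A (b j)) w = cinner (b j) (B w)" if "j < n" for j
  proof (rule clinear_eq_on_basis[OF assms(1), where A = "cinner (A (b j))"
        and B = "\<lambda>w. cinner (b j) (B w)"])
    show "clinear (\<lambda>w. cinner (b j) (B w))"
      unfolding clinear_iff
      by (simp add: cinner_add_right cinner_scaleC_right scaleC_complex_def
          clinear_simps[OF assms(3)])
  qed (use assms that clinear_cinner_right in auto)
  \<comment> \<open>The first argument of \<open>cinner\<close> is conjugate-linear, so the
    extension in \<open>v\<close> is done for the conjugate equation, where \<open>v\<close> stands
    on the right.\<close>
  have "cinner w (A v) = cinner (B w) v"
  proof (rule clinear_eq_on_basis[OF assms(1), where A = "\<lambda>v. cinner w (A v)"
        and B = "cinner (B w)"])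
    show "clinear (\<lambda>v. cinner w (A v))"
      unfolding clinear_iff
      by (simp add: cinner_add_right cinner_scaleC_right scaleC_complex_def
          clinear_simps[OF assms(2)])
    show "cinner w (A (b j)) = cinner (B w) (b j)" if "j < n" for j
      using 1[OF that] by (metis cinner_commute)
  qed (rule clinear_cinner_right)
  then show "cinner (A v) w = cinner v (B w)" by (metis cinner_commute)
qed

text \<open>The map \<open>S\<close> with the conjugate phases is both the inverse and the adjoint
  of \<open>?T\<close>, hence the inner product of \<open>?T v\<close> and \<open>?T w\<close> is
  that of \<open>v\<close> and \<open>S (?T w) = w\<close>.\<close>

lemma unitary_basis_map:
  fixes b :: "nat \<Rightarrow> 'h::complex_inner" and g :: "nat \<Rightarrow> 'k::complex_inner"
  assumes b: "orthonormal_basis n b" and g: "orthonormal_basis n g"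
    and p: "\<And>j. j < n \<Longrightarrow> cmod (p j) = 1"
  shows "unitary_map (basis_map n b (\<lambda>j. scaleC (p j) (g j)))" (is "unitary_map ?T")
  unfolding unitary_map_def
proof (intro conjI allI)
  show lin: "clinear ?T" by (rule clinear_basis_map)
  have pp: "cnj (p j) * p j = 1" if "j < n" for j
    using p[OF that] complex_norm_square[of "p j"] by (simp add: mult.commute)
  define S where "S = basis_map n g (\<lambda>j. scaleC (cnj (p j)) (b j))"
  have pp': "p j * cnj (p j) = 1" if "j < n" for j
    using pp[OF that] by (simp add: mult.commute)
  have linS: "clinear S" unfolding S_def by (rule clinear_basis_map)
  have Tb: "?T (b j) = scaleC (p j) (g j)" if "j < n" for j
    by (rule basis_map_basis[OF b that])
  have Sg: "S (g j) = scaleC (cnj (p j)) (b j)" if "j < n" for j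
    unfolding S_def by (rule basis_map_basis[OF g that])
  have "?T (S v) = id v" for v
    by (rule clinear_eq_on_basis[OF g, where A = "\<lambda>v. ?T (S v)" and B = id])
      (simp_all add: clinear_iff clinear_simps[OF lin] clinear_simps[OF linS] Sg Tb
        scaleC_scaleC pp scaleC_one)
  then show "surj ?T" by (metis id_apply surjI)
  have S: "S (?T v) = id v" for v
    by (rule clinear_eq_on_basis[OF b, where A = "\<lambda>v. S (?T v)" and B = id])
      (simp_all add: clinear_iff clinear_simps[OF lin] clinear_simps[OF linS] Sg Tb
        scaleC_scaleC pp' scaleC_one)
  fix v w
  have "cinner v (S w) = cinner (?T v) w" for v w
  proof -
    have 1: "cinner (b j) (S w) = cinner (?T (b j)) w" if j: "j < n" for j
    proof (rule clinear_eq_on_basis[OF g, where A = "\<lambda>w. cinner (b j) (S w)"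
          and B = "cinner (?T (b j))"])
      show "clinear (\<lambda>w. cinner (b j) (S w))"
        unfolding clinear_iff
        by (simp add: cinner_add_right cinner_scaleC_right scaleC_complex_def
            clinear_simps[OF linS])
      show "clinear (cinner (?T (b j)))" by (rule clinear_cinner_right)
      show "cinner (b j) (S (g k)) = cinner (?T (b j)) (g k)" if "k < n" for k
        using that j
        by (simp add: Sg Tb cinner_scaleC_right cinner_scaleC_left orthonormal_basis_cinner[OF b]
            orthonormal_basis_cinner[OF g])
    qed
    have "cinner (S w) v = cinner w (?T v)"
    proof (rule clinear_eq_on_basis[OF b, where A = "cinner (S w)"
          and B = "\<lambda>v. cinner w (?T v)"])
      show "clinear (\<lambda>v. cinner w (?T v))"
        unfolding clinear_iff
        by (simp add: cinner_add_right cinner_scaleC_right scaleC_complex_def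
            clinear_simps[OF lin])
      show "clinear (cinner (S w))" by (rule clinear_cinner_right)
      show "cinner (S w) (b j) = cinner w (?T (b j))" if "j < n" for j
        using 1[OF that] by (metis cinner_commute)
    qed
    then show ?thesis by (metis cinner_commute)
  qed
  from this[of v "?T w"] show "cinner (?T v) (?T w) = cinner v w" by (simp add: S)
qed

section \<open>Homomorphisms from the algebra\<close>

lemma carrier_alg: "carrier (alg R) = range (cls R)"
  by (auto simp: alg_def FactRing_def A_RCOSETS_def' cls_def free_ring_def)

lemma cls_mult: "cls R p \<otimes>\<^bsub>alg R\<^esub> cls R q = cls R (p * q)"
  using ideal.rcoset_mult_add[OF ideal_rel_ideal, of p q R]
  by (simp add: alg_def FactRing_def cls_def free_ring_def)

lemma cls_add: "cls R p \<oplus>\<^bsub>alg R\<^esub> cls R q = cls R (p + q)"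
proof -
  interpret ideal "rel_ideal R" free_ring by (rule ideal_rel_ideal)
  show ?thesis using a_rcos_sum[of p q]
    by (simp add: alg_def FactRing_def cls_def free_ring_def)
qed

lemma cls_one: "\<one>\<^bsub>alg R\<^esub> = cls R 1"
  by (simp add: alg_def FactRing_def cls_def free_ring_def)

lemma scal_cls: "scal R c (cls R p) = cls R (const c * p)"
  by (simp add: scal_def cls_mult)

text \<open>A monomial is a constant times a product of variables, so closure under sums and
  products reduces everything to constants and single generators.\<close>

lemma free_alg_gen_induct [case_names const var add mult]:
  fixes p :: free_alg
  assumes c: "\<And>c. P (const c)" and v: "\<And>g. P (var g)"
    and add: "\<And>p q. P p \<Longrightarrow> P q \<Longrightarrow> P (p + q)" and mult: "\<And>p q. P p \<Longrightarrow> P q \<Longrightarrow> P (p * q)"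
  shows "P p"
proof (induction p rule: free_alg_induct)
  case zero
  show ?case using c[of 0] by (simp add: const_def)
next
  case (monomial u a)
  have words: "P (Poly_Mapping.single (Word l) 1)" for l
  proof (induction l)
    case Nil
    show ?case using c[of 1] by (simp add: const_def zero_word_def)
  next
    case (Cons g l)
    have "Poly_Mapping.single (Word (g # l)) 1 = var g * Poly_Mapping.single (Word l) 1"
      by (simp add: var_def mult_single plus_word_def)
    then show ?case using mult v Cons by simp
  qed
  have "Poly_Mapping.single u a = const a * Poly_Mapping.single (Word (letters u)) 1"
    by (simp add: const_def mult_single)
  then show ?case using mult c words by metis
qed (rule add)

text \<open>The purely algebraic part of \<open>admissible_rep\<close>, which is enough to compute
  the image of a polynomial from the images of the generators.\<close>

definition alg_action :: "real \<Rightarrow> (free_alg set \<Rightarrow> 'h::complex_inner \<Rightarrow> 'h) \<Rightarrow> bool" where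
  "alg_action R \<Psi> \<longleftrightarrow> \<Psi> \<in> ring_hom (alg R) operators \<and>
     (\<forall>c. \<forall>f\<in>carrier (alg R). \<forall>v. \<Psi> (scal R c f) v = scaleC c (\<Psi> f v))"

lemma admissible_action: "admissible_rep R \<Psi> e \<Longrightarrow> alg_action R \<Psi>"
  by (simp add: admissible_rep_def alg_action_def)

lemma action_simps:
  assumes "alg_action R \<Psi>"
  shows action_add: "\<Psi> (cls R (p + q)) v = \<Psi> (cls R p) v + \<Psi> (cls R q) v"
    and action_mult: "\<Psi> (cls R (p * q)) v = \<Psi> (cls R p) (\<Psi> (cls R q) v)"
    and action_const: "\<Psi> (cls R (const c)) v = scaleC c v"
    and action_minus: "\<Psi> (cls R (p - q)) v = \<Psi> (cls R p) v - \<Psi> (cls R q) v"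
    and action_one: "\<Psi> (cls R 1) v = v"
    and clinear_action: "clinear (\<Psi> (cls R p))"
proof -
  have hom: "\<Psi> \<in> ring_hom (alg R) operators"
    and scal: "\<And>c p v. \<Psi> (cls R (const c * p)) v = scaleC c (\<Psi> (cls R p) v)"
    using assms by (auto simp: alg_action_def carrier_alg simp flip: scal_cls)
  show add: "\<Psi> (cls R (p + q)) v = \<Psi> (cls R p) v + \<Psi> (cls R q) v" for p q v
    using ring_hom_add[OF hom, of "cls R p" "cls R q"]
    by (simp add: carrier_alg cls_add operators_def)
  show "\<Psi> (cls R (p * q)) v = \<Psi> (cls R p) (\<Psi> (cls R q) v)"
    using ring_hom_mult[OF hom, of "cls R p" "cls R q"]
    by (simp add: carrier_alg cls_mult operators_def)
  show one: "\<Psi> (cls R 1) v = v" for v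
    using ring_hom_one[OF hom] by (simp add: cls_one operators_def)
  show "\<Psi> (cls R (const c)) v = scaleC c v"
    using scal[of c 1 v] by (simp add: one)
  show "\<Psi> (cls R (p - q)) v = \<Psi> (cls R p) v - \<Psi> (cls R q) v"
    using add[of "p - q" q v] by simp
  show "clinear (\<Psi> (cls R p))"
    using ring_hom_closed[OF hom, of "cls R p"] by (simp add: carrier_alg operators_def)
qed

lemma action_relators:
  assumes "r \<in> relators R"
    and a: "alg_action R \<Psi>"
  shows "\<Psi> (cls R r) v = 0"
proof -
  have "r \<in> rel_ideal R" by (rule relators_in_rel_ideal[OF assms(1)])
  then have "cls R r = cls R 0"
    by (auto simp: cls_alt) (metis rel_ideal_add, metis add_diff_cancel_right' diff_add_cancel rel_ideal_minus)
  then have "\<Psi> (cls R r) v = \<Psi> (cls R (1 - 1)) v" by simp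
  then show ?thesis unfolding action_minus[OF a] by simp
qed

text \<open>The relation for the inverse forces this value because 1 + e^2 > 0. The action of
  \<open>GInv\<close> is therefore determined by that of \<open>GEps\<close>.\<close>

lemma action_inv:
  assumes a: "alg_action R \<Psi>" and eps: "\<And>v. \<Psi> (elt_eps R) v = scaleC (of_real e) v"
  shows "\<Psi> (cls R fInv) v = scaleC (of_real (1 / (1 + e\<^sup>2))) v"
proof -
  have "\<Psi> (cls R ((1 + fEps * fEps) * fInv - 1)) v = 0"
    by (rule action_relators[OF _ a]) (simp add: relators_def)
  then have eq: "scaleC (of_real (1 + e\<^sup>2)) (\<Psi> (cls R fInv) v) = v"
    by (simp add: action_simps[OF a] eps[unfolded elt_eps_def] scaleC_scaleC scaleC_add_left
        scaleC_one power2_eq_square)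
  have "complex_of_real (1 / (1 + e\<^sup>2)) * of_real (1 + e\<^sup>2) = of_real (1 / (1 + e\<^sup>2) * (1 + e\<^sup>2))"
    by (simp only: of_real_mult)
  also have "1 / (1 + e\<^sup>2) * (1 + e\<^sup>2) = 1"
    by (smt (verit) nonzero_eq_divide_eq zero_le_power2)
  finally have "complex_of_real (1 / (1 + e\<^sup>2)) * of_real (1 + e\<^sup>2) = 1" by simp
  then have "\<Psi> (cls R fInv) v
      = scaleC (of_real (1 / (1 + e\<^sup>2))) (scaleC (of_real (1 + e\<^sup>2)) (\<Psi> (cls R fInv) v))"
    by (simp only: scaleC_scaleC scaleC_one)
  then show ?thesis unfolding eq .
qed

lemma add_diff_eq_cancel:
  fixes a c x y :: complex
  shows "a + x = c + y \<Longrightarrow> a - x = c - y \<Longrightarrow> a = c"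
  by (simp add: complex_eq_iff)

text \<open>The generators are recovered one after the other: x from the sum of a_plus and a_minus,
  y from a_plus and x, and z from u, because w is a polynomial in x and y. The two remaining
  generators act by the same scalars on both sides.\<close>

lemma intertwinesI:
  assumes \<Psi>: "alg_action R \<Psi>" "\<And>v. \<Psi> (elt_eps R) v = scaleC (of_real e) v"
    and \<Phi>: "alg_action R \<Phi>" "\<And>v. \<Phi> (elt_eps R) v = scaleC (of_real e) v"
    and T: "clinear T"
    and u: "\<And>v. T (\<Psi> (elt_u R) v) = \<Phi> (elt_u R) (T v)"
    and plus: "\<And>v. T (\<Psi> (elt_a_plus R) v) = \<Phi> (elt_a_plus R) (T v)"
    and minus: "\<And>v. T (\<Psi> (elt_a_minus R) v) = \<Phi> (elt_a_minus R) (T v)"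
  shows "T (\<Psi> (cls R p) v) = \<Phi> (cls R p) (T v)"
proof -
  note simps = action_simps[OF \<Psi>(1)] action_simps[OF \<Phi>(1)] clinear_simps[OF T]
    cinner_add_right cinner_scaleC_right cinner_diff_right
  have X: "T (\<Psi> (cls R fX) v) = \<Phi> (cls R fX) (T v)" for v
  proof (rule cinner_extensional)
    fix t
    show "cinner t (T (\<Psi> (cls R fX) v)) = cinner t (\<Phi> (cls R fX) (T v))"
      using arg_cong[OF plus[of v], of "cinner t"] arg_cong[OF minus[of v], of "cinner t"]
      unfolding elt_a_plus_def elt_a_minus_def simps by (rule add_diff_eq_cancel)
  qed
  have Y: "T (\<Psi> (cls R fY) v) = \<Phi> (cls R fY) (T v)" for v
  proof (rule cinner_extensional)
    fix t
    have "\<i> * cinner t (T (\<Psi> (cls R fY) v)) = \<i> * cinner t (\<Phi> (cls R fY) (T v))"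
      using arg_cong[OF plus[of v], of "cinner t"] arg_cong[OF X[of v], of "cinner t"]
      unfolding elt_a_plus_def simps by simp
    then show "cinner t (T (\<Psi> (cls R fY) v)) = cinner t (\<Phi> (cls R fY) (T v))" by simp
  qed
  have Z: "T (\<Psi> (cls R fZ) v) = \<Phi> (cls R fZ) (T v)" for v
  proof (rule cinner_extensional)
    fix t
    have "\<i> * cinner t (T (\<Psi> (cls R fZ) v)) = \<i> * cinner t (\<Phi> (cls R fZ) (T v))"
      using arg_cong[OF u[of v], of "cinner t"]
      unfolding elt_u_def fW_def simps X Y by simp
    then show "cinner t (T (\<Psi> (cls R fZ) v)) = cinner t (\<Phi> (cls R fZ) (T v))" by simp
  qed
  show ?thesis
  proof (induction p arbitrary: v rule: free_alg_gen_induct)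
    case (var g)
    show ?case
      using X Y Z \<Psi>(2) \<Phi>(2) action_inv[OF \<Psi>] action_inv[OF \<Phi>] clinear_simps(2)[OF T]
      by (cases g) (simp_all add: elt_eps_def)
  qed (simp_all add: simps)
qed

section \<open>Evaluating noncommutative polynomials\<close>

text \<open>\<open>foldr\<close> lets the last letter of a word act first, so that concatenation of
  words becomes composition of operators.\<close>

definition free_eval :: "(gen \<Rightarrow> 'h::complex_inner \<Rightarrow> 'h) \<Rightarrow> free_alg \<Rightarrow> 'h \<Rightarrow> 'h" where
  "free_eval \<rho> p v =
     (\<Sum>u\<in>Poly_Mapping.keys p. scaleC (Poly_Mapping.lookup p u) (foldr \<rho> (letters u) v))"

lemma free_eval_add: "free_eval \<rho> (p + q) v = free_eval \<rho> p v + free_eval \<rho> q v"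
  unfolding free_eval_def
  by (rule setsum_keys_plus_distrib) (simp_all add: cvs.scale_zero_left scaleC_add_left)

lemma free_eval_zero: "free_eval \<rho> 0 v = 0"
  by (simp add: free_eval_def)

lemma free_eval_single: "free_eval \<rho> (Poly_Mapping.single u c) v = scaleC c (foldr \<rho> (letters u) v)"
  by (simp add: free_eval_def cvs.scale_zero_left)

lemma free_eval_const: "free_eval \<rho> (const c) v = scaleC c v"
  by (simp add: const_def free_eval_single zero_word_def)

lemma free_eval_var: "free_eval \<rho> (var g) v = \<rho> g v"
  by (simp add: var_def free_eval_single scaleC_one)

lemma free_eval_one: "free_eval \<rho> 1 v = v"
  by (metis const_def free_eval_const scaleC_one single_one)

lemma free_eval_minus: "free_eval \<rho> (p - q) v = free_eval \<rho> p v - free_eval \<rho> q v"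
  using free_eval_add[of \<rho> "p - q" q v] by simp

context
  fixes \<rho> :: "gen \<Rightarrow> 'h::complex_inner \<Rightarrow> 'h"
  assumes lin: "\<And>g. clinear (\<rho> g)"
begin

lemma clinear_foldr: "clinear (foldr \<rho> l)"
  by (induction l) (simp_all add: clinear_iff clinear_simps[OF lin])

lemma clinear_free_eval: "clinear (free_eval \<rho> p)"
  unfolding clinear_iff free_eval_def
  by (simp add: clinear_simps[OF clinear_foldr] scaleC_add_right sum.distrib
      cvs.scale_sum_right scaleC_scaleC mult.commute)

lemma free_eval_mult: "free_eval \<rho> (p * q) v = free_eval \<rho> p (free_eval \<rho> q v)"
proof (induction p rule: free_alg_induct)
  case (monomial u c)
  show ?case
    by (induction q rule: free_alg_induct)
      (simp_all add: mult_single free_eval_single free_eval_add free_eval_zero distrib_left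
        plus_word_def scaleC_scaleC scaleC_add_right clinear_simps[OF clinear_foldr])
qed (simp_all add: free_eval_add free_eval_zero distrib_right)

text \<open>For self-adjoint generators, taking adjoints reverses products and conjugates
  coefficients, which is exactly what \<open>star\<close> does to words.\<close>

lemma free_eval_adjoint:
  assumes self: "\<And>g. adjoint_pair (\<rho> g) (\<rho> g)"
  shows "adjoint_pair (free_eval \<rho> p) (free_eval \<rho> (star p))"
  unfolding adjoint_pair_def
proof (induction p rule: free_alg_gen_induct)
  case (var g)
  then show ?case using self by (simp add: free_eval_var star_var adjoint_pair_def)
qed (simp_all add: free_eval_add free_eval_mult free_eval_const star_add star_mult star_const
      cinner_add_left cinner_add_right cinner_scaleC_left cinner_scaleC_right)

end

text \<open>A coset is evaluated at an arbitrarily chosen representative;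
  \<open>quotient_eval_cls\<close> shows that the choice does not matter once all relators evaluate
  to 0.\<close>

definition quotient_eval ::
  "(gen \<Rightarrow> 'h::complex_inner \<Rightarrow> 'h) \<Rightarrow> free_alg set \<Rightarrow> 'h \<Rightarrow> 'h"
  where "quotient_eval \<rho> f = free_eval \<rho> (SOME p. p \<in> f)"

context
  fixes R :: real and \<rho> :: "gen \<Rightarrow> 'h::complex_inner \<Rightarrow> 'h"
  assumes lin: "\<And>g. clinear (\<rho> g)"
    and rel: "\<And>r v. r \<in> relators R \<Longrightarrow> free_eval \<rho> r v = 0"
begin

text \<open>The polynomials evaluating to the zero operator form a two-sided ideal, and
  \<open>rel_ideal R\<close> is the least one that contains the relators.\<close>

lemma free_eval_rel_ideal: "p \<in> rel_ideal R \<Longrightarrow> free_eval \<rho> p v = 0"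
proof -
  have "rel_ideal R \<subseteq> {p. \<forall>v. free_eval \<rho> p v = 0}"
    by (rule rel_ideal_minimal)
      (auto simp: rel free_eval_zero free_eval_add free_eval_mult[OF lin]
        clinear_simps[OF clinear_free_eval[OF lin]])
  then show "p \<in> rel_ideal R \<Longrightarrow> free_eval \<rho> p v = 0" by blast
qed

lemma quotient_eval_cls: "quotient_eval \<rho> (cls R p) = free_eval \<rho> p"
proof
  fix v
  have "p \<in> cls R p" using rel_ideal_zero by (force simp: cls_alt)
  then have "(SOME q. q \<in> cls R p) \<in> cls R p" by (rule someI)
  then obtain q where "q \<in> rel_ideal R" "(SOME q. q \<in> cls R p) = q + p"
    by (auto simp: cls_alt)
  then show "quotient_eval \<rho> (cls R p) v = free_eval \<rho> p v"
    by (simp add: quotient_eval_def free_eval_add free_eval_rel_ideal)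
qed

lemma quotient_eval_hom: "quotient_eval \<rho> \<in> ring_hom (alg R) operators"
  by (rule ring_hom_memI)
    (auto simp: carrier_alg cls_mult cls_add cls_one quotient_eval_cls operators_def
      clinear_free_eval[OF lin] free_eval_mult[OF lin] free_eval_add free_eval_one)

end

section \<open>The equation for the angle\<close>

text \<open>The numerator of the derivative is n sin(nx) cos x - cos(nx) sin x = sin((n-1)x) + (n-1)
  sin(nx) cos x. Both summands are positive, since (n-1)x and nx lie in (0, \<pi>) and x <
  \<pi>/2.\<close>

lemma ladder_ratio_strict_mono:
  fixes n :: nat and s t :: real
  assumes n: "2 \<le> n" and "0 < s" "s < t" "t < pi / real n"
  shows "- cos (real n * s) / cos s < - cos (real n * t) / cos t"
proof (rule DERIV_pos_imp_increasing[OF \<open>s < t\<close>])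
  fix x assume x: "s \<le> x" "x \<le> t"
  have "0 < x" "x < pi / real n" using x assms by auto
  then have "real n * x < pi" using n by (simp add: field_simps)
  have "2 * x \<le> real n * x" using n \<open>0 < x\<close> by (intro mult_right_mono) auto
  then have x2: "x < pi / 2" using \<open>real n * x < pi\<close> by linarith
  then have c: "cos x > 0" using \<open>0 < x\<close> by (intro cos_gt_zero_pi) auto
  have s1: "sin ((real n - 1) * x) > 0"
    using n \<open>0 < x\<close> \<open>real n * x < pi\<close> by (intro sin_gt_zero) (auto simp: algebra_simps)
  have s2: "sin (real n * x) > 0"
    using n \<open>0 < x\<close> \<open>real n * x < pi\<close> by (intro sin_gt_zero) auto
  have eq: "real n * sin (real n * x) * cos x - cos (real n * x) * sin x
      = - (sin x * cos (real n * x) - real n * (cos x * sin (real n * x)))"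
    by (simp add: algebra_simps)
  have "((\<lambda>x. - cos (real n * x) / cos x) has_real_derivative
      - ((sin x * cos (real n * x) - real n * (cos x * sin (real n * x))) / (cos x * cos x))) (at x)"
    using c by (auto intro!: derivative_eq_intros simp: algebra_simps)
  then have "((\<lambda>x. - cos (real n * x) / cos x) has_real_derivative
      (real n * sin (real n * x) * cos x - cos (real n * x) * sin x) / (cos x)\<^sup>2) (at x)"
    by (simp only: eq power2_eq_square minus_divide_left)
  moreover have "sin ((real n - 1) * x) = sin (real n * x) * cos x - cos (real n * x) * sin x"
    by (simp add: left_diff_distrib sin_diff)
  then have "real n * sin (real n * x) * cos x - cos (real n * x) * sin x
      = sin ((real n - 1) * x) + (real n - 1) * (sin (real n * x) * cos x)"
    by (simp add: algebra_simps)
  then have "real n * sin (real n * x) * cos x - cos (real n * x) * sin x > 0"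
    using s1 s2 c n by (simp add: add_pos_nonneg)
  ultimately show "\<exists>y. ((\<lambda>x. - cos (real n * x) / cos x) has_real_derivative y) (at x) \<and> 0 < y"
    using c by (metis divide_pos_pos zero_less_power)
qed

lemma half_angle_cos_pos:
  fixes n :: nat and t :: real
  assumes "2 \<le> n" "0 \<le> t" "t < pi / real n"
  shows "0 < cos t"
proof -
  have "pi / real n \<le> pi / 2" using assms(1) by (intro divide_left_mono) auto
  then have "- (pi / 2) < t" "t < pi / 2" using assms(2,3) pi_gt_zero by linarith+
  then show ?thesis by (rule cos_gt_zero_pi)
qed

lemma ladder_root_unique:
  fixes n :: nat and s t R :: real
  assumes n: "2 \<le> n" and "0 < s" "s < pi / real n" "0 < t" "t < pi / real n"
    and "cos (real n * s) + R * cos s = 0" "cos (real n * t) + R * cos t = 0"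
  shows "s = t"
proof -
  have "cos s > 0" "cos t > 0" using half_angle_cos_pos[OF n] assms by auto
  then have "- cos (real n * s) / cos s = R" "- cos (real n * t) / cos t = R"
    using assms(6,7) by (simp_all add: field_simps)
  then show ?thesis
    using ladder_ratio_strict_mono[OF n, of s t] ladder_ratio_strict_mono[OF n, of t s] assms(2-5)
    by (cases s t rule: linorder_cases) auto
qed

text \<open>The function cos(nt) + R cos t takes the value 1 + R at 0 and R cos(\<pi>/n) - 1 at
  \<pi>/n, and the bounds on R give these opposite signs. Conversely, at a root, cos(nt) < cos t
  yields the lower bound, and R cos t = - cos(nt) < 1 together with cos(\<pi>/n) < cos t the upper
  one.\<close>

lemma ladder_root_iff:
  fixes n :: nat and R :: real
  assumes n: "2 \<le> n"
  shows "(\<exists>t. 0 < t \<and> t < pi / real n \<and> cos (real n * t) + R * cos t = 0) \<longleftrightarrow>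
    - 1 < R \<and> (n = 2 \<or> R < 1 / cos (pi / real n))"
proof
  assume "\<exists>t. 0 < t \<and> t < pi / real n \<and> cos (real n * t) + R * cos t = 0"
  then obtain t where t: "0 < t" "t < pi / real n" and eq: "cos (real n * t) + R * cos t = 0" by blast
  have c: "0 < cos t" using half_angle_cos_pos[OF n] t by auto
  have nt: "t < real n * t" "real n * t < pi" using n t by (simp_all add: pos_less_divide_eq mult.commute)
  then have "cos (real n * t) < cos t" using t by (intro cos_monotone_0_pi) auto
  then have "0 < (R + 1) * cos t" using eq by (simp add: algebra_simps)
  then have "- 1 < R" using c by (simp add: zero_less_mult_iff)
  moreover have "R < 1 / cos (pi / real n)" if "n \<noteq> 2"
  proof -
    have "pi / real n < pi / 2" using n that by (intro divide_strict_left_mono) auto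
    then have cp: "0 < cos (pi / real n)"
      using t pi_gt_zero by (intro cos_gt_zero_pi) linarith+
    have "cos pi < cos (real n * t)" using nt t by (intro cos_monotone_0_pi) auto
    then have lt: "R * cos t < 1" using eq by simp
    have "cos (pi / real n) < cos t"
      using t \<open>pi / real n < pi / 2\<close> pi_gt_zero by (intro cos_monotone_0_pi) linarith+
    \<comment> \<open>Multiplying cos(\<pi>/n) < cos t by R keeps its direction only for nonnegative
      R; otherwise the product is at most 0 anyway.\<close>
    then have "R * cos (pi / real n) < 1"
    proof (cases "0 \<le> R")
      case True
      then have "R * cos (pi / real n) \<le> R * cos t"
        using \<open>cos (pi / real n) < cos t\<close> by (intro mult_left_mono) auto
      then show ?thesis using lt by linarith
    next
      case False
      then have "R * cos (pi / real n) \<le> 0"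
        using cp by (intro mult_nonpos_nonneg) auto
      then show ?thesis by linarith
    qed
    then show ?thesis using cp by (simp add: field_simps)
  qed
  ultimately show "- 1 < R \<and> (n = 2 \<or> R < 1 / cos (pi / real n))" by blast
next
  assume R: "- 1 < R \<and> (n = 2 \<or> R < 1 / cos (pi / real n))"
  define g where "g t = cos (real n * t) + R * cos t" for t :: real
  \<comment> \<open>For n = 2 the cosine is 0 and the claim is 0 < 1.\<close>
  have "R * cos (pi / real n) < 1"
  proof (cases "n = 2")
    case False
    then have "pi / real n < pi / 2" using n by (intro divide_strict_left_mono) auto
    moreover have "0 \<le> pi / real n" by simp
    ultimately have "0 < cos (pi / real n)"
      using pi_gt_zero by (intro cos_gt_zero_pi) linarith+
    then show ?thesis using R False by (simp add: field_simps)
  qed simp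
  then have g1: "g (pi / real n) < 0" using n by (simp add: g_def)
  have g0: "0 < g 0" using R by (simp add: g_def)
  have "\<exists>t\<ge>0. t \<le> pi / real n \<and> g t = 0"
    using g0 g1 by (intro IVT2') (auto simp: g_def intro!: continuous_intros)
  then obtain t where t: "0 \<le> t" "t \<le> pi / real n" "g t = 0" by blast
  then have "t \<noteq> 0" "t \<noteq> pi / real n" using g0 g1 by auto
  then have "0 < t" "t < pi / real n" using t by linarith+
  with t(3) show "\<exists>t. 0 < t \<and> t < pi / real n \<and> cos (real n * t) + R * cos t = 0"
    unfolding g_def by blast
qed

text \<open>Any two of the angles differ by less than a full turn, so they cannot meet on the
  circle. In this way n\<alpha> < 2\<pi> makes the spectrum of u simple.\<close>

lemma cis_arithmetic_progression_inj:
  fixes \<alpha> \<beta> :: real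
  assumes "0 < \<alpha>" "real n * \<alpha> < 2 * pi" "j < n" "k < n"
    and "cis (\<beta> + real j * \<alpha>) = cis (\<beta> + real k * \<alpha>)"
  shows "j = k"
  using assms
proof (induction j k rule: linorder_wlog)
  case (le j k)
  let ?d = "(real k - real j) * \<alpha>"
  have "cis ?d = cis (\<beta> + real k * \<alpha>) / cis (\<beta> + real j * \<alpha>)"
    by (simp add: cis_divide algebra_simps)
  then have "cis ?d = 1" using le by simp
  then have "cos ?d = 1" by (metis cis.simps(1) one_complex.simps(1))
  then obtain i :: int where i: "?d = of_int i * 2 * pi" by (auto simp: cos_one_2pi_int)
  have "0 \<le> ?d" using le by simp
  have "?d \<le> real n * \<alpha>" using le by (intro mult_right_mono) auto
  then have "real_of_int i * (2 * pi) < 1 * (2 * pi)" using i le(3) by linarith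
  then have "real_of_int i < 1" by (subst (asm) mult_less_cancel_right_pos) auto
  then have "i < 1" by simp
  have "0 \<le> real_of_int i * (2 * pi)" using i \<open>0 \<le> ?d\<close> by linarith
  then have "0 \<le> i" using mult_neg_pos[of "real_of_int i" "2 * pi"] by (cases "i < 0") auto
  then have "i = 0" using \<open>i < 1\<close> by simp
  then show ?case using i le(2) by simp
qed auto

text \<open>With h = n\<alpha>/2, the difference of the two end cosines is 2 sin(t + h) sin h, and
  sin h > 0, so t + h is a multiple of \<pi>; the ranges of t and h leave only 0 and -\<pi>.\<close>

lemma ladder_parameters:
  fixes n :: nat and \<alpha> t R :: real
  assumes n: "2 \<le> n" and \<alpha>: "0 < \<alpha>" "real n * \<alpha> < 2 * pi"
    and t: "- 2 * pi < t" "t \<le> 0"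
    and ends: "cos t = - R * cos (\<alpha> / 2)" "cos (t + real n * \<alpha>) = - R * cos (\<alpha> / 2)"
    and pos: "- R * cos (\<alpha> / 2) < cos (t + \<alpha>)"
  shows "t = - (real n * \<alpha> / 2)"
proof -
  let ?h = "real n * \<alpha> / 2"
  have h: "0 < ?h" "?h < pi" using n \<alpha> by auto
  have "cos t - cos (t + real n * \<alpha>) = 0" using ends by simp
  then have "sin (t + ?h) * sin ?h = 0"
    by (simp add: cos_diff_cos algebra_simps add_divide_distrib)
  moreover have "sin ?h > 0" using h by (rule sin_gt_zero)
  ultimately have "sin (t + ?h) = 0" by simp
  then obtain i :: int where i: "t + ?h = of_int i * pi" by (auto simp: sin_zero_iff_int2)
  have "real_of_int i * pi < 1 * pi" "- 2 * pi < real_of_int i * pi" using i h t by linarith+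
  then have "real_of_int i < 1" "- 2 < real_of_int i"
    using mult_less_cancel_right_pos[OF pi_gt_zero] by blast+
  then have "i < 1" "- 2 < i" by linarith+
  then consider "i = 0" | "i = - 1" by linarith
  then show ?thesis
  proof cases
    case 2
    \<comment> \<open>Here the cosines change sign: cos(t + \<alpha>) = - cos(h - \<alpha>) lies
      below cos t = - cos h because |h - \<alpha>| < h, which contradicts
      \<open>pos\<close>.\<close>
    then have t: "t = - pi - ?h" using i by simp
    have "cos t = - cos ?h" unfolding t by (simp add: cos_diff)
    moreover have "cos (t + \<alpha>) = - cos (?h - \<alpha>)" unfolding t
      by (simp add: cos_diff cos_add sin_diff sin_add)
    moreover have "\<bar>?h - \<alpha>\<bar> < ?h"
    proof -
      have "2 * \<alpha> \<le> real n * \<alpha>" using n \<alpha> by (intro mult_right_mono) auto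
      then show ?thesis using \<alpha> by auto
    qed
    then have "cos ?h < cos \<bar>?h - \<alpha>\<bar>" using h by (intro cos_monotone_0_pi) auto
    ultimately show ?thesis using ends pos by simp
  qed (use i in simp)
qed

section \<open>The ladder representation\<close>

lemma cos_half_shift_add:
  fixes \<theta> \<alpha> :: real
  assumes "cos (\<alpha> / 2) \<noteq> 0"
  shows "1 / cos (\<alpha> / 2) * cos (\<theta> + \<alpha> / 2) + 1 / cos (\<alpha> / 2) * cos (\<theta> - \<alpha> / 2) = 2 * cos \<theta>"
proof -
  have "cos (\<theta> + \<alpha> / 2) + cos (\<theta> - \<alpha> / 2) = 2 * cos \<theta> * cos (\<alpha> / 2)"
    by (simp add: cos_add cos_diff)
  then show ?thesis using assms by (simp flip: add_divide_distrib)
qed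

lemma cos_half_shift_diff:
  fixes \<theta> \<alpha> :: real
  shows "1 / cos (\<alpha> / 2) * cos (\<theta> - \<alpha> / 2) - 1 / cos (\<alpha> / 2) * cos (\<theta> + \<alpha> / 2)
    = 2 * tan (\<alpha> / 2) * sin \<theta>"
  by (simp add: cos_add cos_diff tan_def diff_divide_distrib[symmetric])

text \<open>Quotient of two sum-to-product formulas. The eigenvalue of z changes along one rung by
  an amount that involves w on both rungs, as the commutators with z require.\<close>

lemma sin_step:
  fixes \<theta> \<alpha> :: real
  assumes "cos (\<alpha> / 2) \<noteq> 0"
  shows "sin (\<theta> + \<alpha>) - sin \<theta> = tan (\<alpha> / 2) * (cos (\<theta> + \<alpha>) + cos \<theta>)"
proof -
  have "sin (\<theta> + \<alpha>) - sin \<theta> = 2 * sin (\<alpha> / 2) * cos (\<theta> + \<alpha> / 2)"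
    by (simp add: sin_diff_sin add_divide_distrib)
  moreover have "cos (\<theta> + \<alpha>) + cos \<theta> = 2 * cos (\<theta> + \<alpha> / 2) * cos (\<alpha> / 2)"
    by (simp add: cos_plus_cos add_divide_distrib)
  ultimately show ?thesis using assms by (simp add: tan_def)
qed

lemma half_sum_diff:
  fixes r l :: complex
  shows "1 / 2 * (r + l) + \<i> * (- \<i> / 2 * (r - l)) = r"
    and "1 / 2 * (r + l) - \<i> * (- \<i> / 2 * (r - l)) = l"
  by (simp_all add: complex_eq_iff field_simps)

section \<open>Operators on a ladder whose end coefficients vanish\<close>

context
  fixes R \<alpha> \<beta> :: real and n :: nat and b :: "nat \<Rightarrow> 'h::complex_inner" and C :: "nat \<Rightarrow> complex"
  assumes b: "orthonormal_basis n b" and n: "0 < n"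
    and \<alpha>: "0 < \<alpha>" "\<alpha> < pi" "real n * \<alpha> < 2 * pi"
    and C_norm: "\<And>m. m \<le> n \<Longrightarrow>
      (cmod (C m))\<^sup>2 = 1 / cos (\<alpha> / 2) * cos (\<beta> - \<alpha> / 2 + real m * \<alpha>) + R"
    and C_nonzero: "\<And>m. 1 \<le> m \<Longrightarrow> m < n \<Longrightarrow> C m \<noteq> 0"
    and C_ends: "C 0 = 0" "C n = 0"
begin

text \<open>At \<open>j = n - 1\<close> this refers to \<open>b n\<close>, which is not a basis
  vector and about which nothing is assumed; the coefficient \<open>cnj (C n)\<close> is 0
  there.\<close>

private definition "raise = basis_map n b (\<lambda>j. scaleC (cnj (C (Suc j))) (b (Suc j)))"
text \<open>Natural subtraction turns \<open>b (0 - 1)\<close> into \<open>b 0\<close>, but with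
  coefficient \<open>C 0 = 0\<close>, so \<open>b 0\<close> is annihilated as intended.\<close>

private definition "lower = basis_map n b (\<lambda>j. scaleC (C j) (b (j - 1)))"
private definition "diag d = basis_map n b (\<lambda>j. scaleC (d j) (b j))" for d :: "nat \<Rightarrow> complex"
private definition "\<theta> j = \<beta> + real j * \<alpha>" for j :: nat

private definition "zop = diag (\<lambda>j. of_real (sin (\<theta> j)))"
private definition "wop = diag (\<lambda>j. of_real (cos (\<theta> j)))"

text \<open>The operators for x and y solve x + iy = \<open>raise\<close> and x - iy =
  \<open>lower\<close>. As w is not a generator, it remains to be proved, in \<open>eval_w\<close>,
  that x^2 + y^2 - R acts as \<open>wop\<close>.\<close>

private definition ladder :: "gen \<Rightarrow> 'h \<Rightarrow> 'h" where
  "ladder g v = (case g of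
     GX \<Rightarrow> scaleC (1 / 2) (raise v + lower v)
   | GY \<Rightarrow> scaleC (- \<i> / 2) (raise v - lower v)
   | GZ \<Rightarrow> zop v
   | GEps \<Rightarrow> scaleC (of_real (tan (\<alpha> / 2))) v
   | GInv \<Rightarrow> scaleC (of_real (1 / (1 + (tan (\<alpha> / 2))\<^sup>2))) v)"

private lemma cos_half: "cos (\<alpha> / 2) > 0"
  using \<alpha> by (intro cos_gt_zero_pi) auto

private lemma linear_ops [simp]: "clinear raise" "clinear lower" "clinear (diag d)"
  "clinear zop" "clinear wop"
  by (simp_all add: zop_def wop_def raise_def lower_def diag_def clinear_basis_map)

private lemma linear_comp: "clinear A \<Longrightarrow> clinear B \<Longrightarrow> clinear (\<lambda>v. A (B v))"
  by (simp add: clinear_iff)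

private lemma linear_lincomb:
  "clinear A \<Longrightarrow> clinear B \<Longrightarrow> clinear (\<lambda>v. scaleC c (A v) + scaleC d (B v))"
  by (simp add: clinear_iff scaleC_add_right scaleC_scaleC mult.commute)

private lemmas op_simps =
  clinear_simps[OF linear_ops(1)] clinear_simps[OF linear_ops(2)] clinear_simps[OF linear_ops(3)]
  clinear_simps[OF linear_ops(4)] clinear_simps[OF linear_ops(5)]

private lemma op_basis:
  assumes "j < n"
  shows "raise (b j) = scaleC (cnj (C (Suc j))) (b (Suc j))"
    "lower (b j) = scaleC (C j) (b (j - 1))"
    "diag d (b j) = scaleC (d j) (b j)"
  using assms by (simp_all add: raise_def lower_def diag_def basis_map_basis[OF b])

private lemma linear_ladder: "clinear (ladder g)"
  by (cases g)
    (simp_all add: clinear_iff ladder_def op_simps scaleC_add_right scaleC_scaleC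
      cvs.scale_right_diff_distrib mult.commute)

private lemma ladder_eps: "ladder GEps v = scaleC (of_real (tan (\<alpha> / 2))) v"
  by (simp add: ladder_def)

private lemmas eval_simps =
  free_eval_minus free_eval_add free_eval_mult[OF linear_ladder] free_eval_var
  free_eval_const free_eval_one

private lemmas cinner_simps =
  cinner_add_right cinner_diff_right cinner_scaleC_right cinner_zero_right

section \<open>Verification of the defining relations\<close>

private lemma diag_eqI:
  assumes "clinear A" "\<And>j. j < n \<Longrightarrow> A (b j) = scaleC (d j) (b j)"
  shows "A v = diag d v"
  by (rule clinear_eq_on_basis[OF b assms(1)]) (simp_all add: assms op_basis)

private lemma lower_raise: "lower (raise v) = diag (\<lambda>j. of_real ((cmod (C (Suc j)))\<^sup>2)) v"
proof (rule diag_eqI)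
  fix j assume j: "j < n"
  show "lower (raise (b j)) = scaleC (of_real ((cmod (C (Suc j)))\<^sup>2)) (b j)"
  proof (cases "Suc j = n")
    case False
    then show ?thesis using j complex_norm_square[of "C (Suc j)"]
      by (simp add: op_basis op_simps scaleC_scaleC mult.commute)
  qed (use j C_ends in \<open>simp add: op_basis op_simps cvs.scale_zero_left\<close>)
qed (simp add: linear_comp)

private lemma raise_lower: "raise (lower v) = diag (\<lambda>j. of_real ((cmod (C j))\<^sup>2)) v"
proof (rule diag_eqI)
  fix j assume j: "j < n"
  show "raise (lower (b j)) = scaleC (of_real ((cmod (C j))\<^sup>2)) (b j)"
  proof (cases "j = 0")
    case False
    then show ?thesis using j complex_norm_square[of "C j"]
      by (simp add: op_basis op_simps scaleC_scaleC)
  qed (use j C_ends in \<open>simp add: op_basis op_simps cvs.scale_zero_left\<close>)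
qed (simp add: linear_comp)

text \<open>A coefficient belongs to the step between two adjacent angles and is centred at their
  midpoint, so rung \<open>j\<close> sees its two coefficients half a step below and half a step
  above.\<close>

private lemma cmod_C:
  assumes "j < n"
  shows "(cmod (C j))\<^sup>2 = 1 / cos (\<alpha> / 2) * cos (\<theta> j - \<alpha> / 2) + R"
    "(cmod (C (Suc j)))\<^sup>2 = 1 / cos (\<alpha> / 2) * cos (\<theta> j + \<alpha> / 2) + R"
proof -
  have e: "\<beta> - \<alpha> / 2 + real j * \<alpha> = \<theta> j - \<alpha> / 2" "\<beta> - \<alpha> / 2 + real (Suc j) * \<alpha> = \<theta> j + \<alpha> / 2"
    by (simp_all add: \<theta>_def algebra_simps)
  show "(cmod (C j))\<^sup>2 = 1 / cos (\<alpha> / 2) * cos (\<theta> j - \<alpha> / 2) + R"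
    "(cmod (C (Suc j)))\<^sup>2 = 1 / cos (\<alpha> / 2) * cos (\<theta> j + \<alpha> / 2) + R"
    using C_norm[of j] C_norm[of "Suc j"] assms unfolding e by simp_all
qed

text \<open>The left side is x^2 + y^2. On \<open>b j\<close> it is the mean of the two neighbouring
  squared norms, and \<open>cos_half_shift_add\<close> removes the half steps.\<close>

private lemma ladder_anticommutator:
  "scaleC (1 / 2) (raise (lower v)) + scaleC (1 / 2) (lower (raise v))
     = diag (\<lambda>j. of_real (cos (\<theta> j) + R)) v"
proof (rule diag_eqI)
  fix j assume j: "j < n"
  have "(cmod (C j))\<^sup>2 + (cmod (C (Suc j)))\<^sup>2 = 2 * (cos (\<theta> j) + R)"
    using cos_half_shift_add[of \<alpha> "\<theta> j"] cos_half cmod_C[OF j] by simp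
  then have "complex_of_real ((cmod (C j))\<^sup>2) + of_real ((cmod (C (Suc j)))\<^sup>2)
      = 2 * of_real (cos (\<theta> j) + R)"
    by (simp only: flip: of_real_add) simp
  then have "1 / 2 * complex_of_real ((cmod (C j))\<^sup>2) + 1 / 2 * of_real ((cmod (C (Suc j)))\<^sup>2)
      = of_real (cos (\<theta> j) + R)"
    by (simp add: field_simps)
  then show "scaleC (1 / 2) (raise (lower (b j))) + scaleC (1 / 2) (lower (raise (b j)))
      = scaleC (of_real (cos (\<theta> j) + R)) (b j)"
    unfolding lower_raise raise_lower op_basis(3)[OF j] scaleC_scaleC
    by (simp only: flip: scaleC_add_left)
qed (simp add: clinear_iff op_simps scaleC_add_right scaleC_scaleC algebra_simps)

private lemma ladder_commutator:
  "scaleC 1 (raise (lower v)) + scaleC (- 1) (lower (raise v))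
     = scaleC (2 * of_real (tan (\<alpha> / 2))) (zop v)"
proof -
  have "scaleC 1 (raise (lower v)) + scaleC (- 1) (lower (raise v))
     = diag (\<lambda>j. 2 * of_real (tan (\<alpha> / 2)) * of_real (sin (\<theta> j))) v"
  proof (rule diag_eqI)
    fix j assume j: "j < n"
    have "(cmod (C j))\<^sup>2 - (cmod (C (Suc j)))\<^sup>2 = 2 * tan (\<alpha> / 2) * sin (\<theta> j)"
      using cos_half_shift_diff[of \<alpha> "\<theta> j"] cmod_C[OF j] by simp
    then have "1 * complex_of_real ((cmod (C j))\<^sup>2) + - 1 * of_real ((cmod (C (Suc j)))\<^sup>2)
        = of_real (2 * tan (\<alpha> / 2) * sin (\<theta> j))"
      by (metis add_uminus_conv_diff mult_1 mult_minus1 of_real_diff)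
    then show "scaleC 1 (raise (lower (b j))) + scaleC (- 1) (lower (raise (b j)))
        = scaleC (2 * of_real (tan (\<alpha> / 2)) * of_real (sin (\<theta> j))) (b j)"
      unfolding lower_raise raise_lower op_basis(3)[OF j] scaleC_scaleC
      by (simp flip: cvs.scale_left_diff_distrib)
  qed (simp add: clinear_iff op_simps scaleC_add_right scaleC_scaleC
      cvs.scale_right_diff_distrib scaleC_one algebra_simps)
  also have "\<dots> = scaleC (2 * of_real (tan (\<alpha> / 2))) (zop v)"
    by (rule diag_eqI[symmetric])
      (simp_all add: zop_def op_basis scaleC_scaleC clinear_iff op_simps scaleC_add_right
        mult.commute)
  finally show ?thesis .
qed

private lemma eval_w: "free_eval ladder (fW R) v = wop v"
proof (rule cinner_extensional)
  fix t
  have "scaleC 1 (wop v) + scaleC (of_real R) (id v) = diag (\<lambda>j. of_real (cos (\<theta> j) + R)) v"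
  proof (rule diag_eqI)
    show "clinear (\<lambda>v. scaleC 1 (wop v) + scaleC (of_real R) (id v))"
      by (intro linear_lincomb linear_ops cvs.linear_id)
  qed (simp add: wop_def op_basis scaleC_one scaleC_add_left)
  then have "cinner t (scaleC 1 (wop v) + scaleC (of_real R) (id v))
      = cinner t (scaleC (1 / 2) (raise (lower v)) + scaleC (1 / 2) (lower (raise v)))"
    by (simp only: ladder_anticommutator)
  then have "cinner t (wop v) = 1 / 2 * cinner t (raise (lower v))
      + 1 / 2 * cinner t (lower (raise v)) - of_real R * cinner t v"
    by (simp add: cinner_simps eq_diff_eq)
  then show "cinner t (free_eval ladder (fW R) v) = cinner t (wop v)"
    unfolding fW_def eval_simps
    by (simp add: ladder_def op_simps cinner_simps algebra_simps)
qed

private lemma trig_step: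
  "complex_of_real (sin (\<theta> (Suc j))) = of_real (sin (\<theta> j))
     + of_real (tan (\<alpha> / 2)) * (of_real (cos (\<theta> (Suc j))) + of_real (cos (\<theta> j)))"
proof -
  have "\<theta> (Suc j) = \<theta> j + \<alpha>" by (simp add: \<theta>_def algebra_simps)
  then have "sin (\<theta> (Suc j)) = sin (\<theta> j) + tan (\<alpha> / 2) * (cos (\<theta> (Suc j)) + cos (\<theta> j))"
    using sin_step[of \<alpha> "\<theta> j"] cos_half by simp
  then show ?thesis by (metis of_real_add of_real_mult)
qed

text \<open>This is the combination of the relations for [y,z] and [z,x] that climbs one rung;
  \<open>z_lower\<close> is the one that descends, with the opposite sign. On \<open>b j\<close>
  both sides are multiples of \<open>b (Suc j)\<close>, compared by
  \<open>trig_step\<close>.\<close>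

private lemma z_raise:
  "zop (raise v) = raise (zop v) + scaleC (of_real (tan (\<alpha> / 2))) (wop (raise v) + raise (wop v))"
  (is "?A v = ?B v")
proof (rule clinear_eq_on_basis[OF b, where A = ?A and B = ?B])
  fix j assume j: "j < n"
  show "?A (b j) = ?B (b j)"
    by (cases "Suc j = n")
      (use j C_ends in \<open>simp_all add: zop_def wop_def op_basis op_simps scaleC_scaleC
        cvs.scale_zero_left trig_step algebra_simps flip: scaleC_add_left\<close>)
qed (simp_all add: clinear_iff op_simps scaleC_add_right scaleC_scaleC algebra_simps)

private lemma z_lower:
  "zop (lower v) = lower (zop v) - scaleC (of_real (tan (\<alpha> / 2))) (wop (lower v) + lower (wop v))"
  (is "?A v = ?B v")
proof (rule clinear_eq_on_basis[OF b, where A = ?A and B = ?B])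
  fix j assume j: "j < n"
  show "?A (b j) = ?B (b j)"
    by (cases j)
      (use j C_ends in \<open>simp_all add: zop_def wop_def op_basis op_simps scaleC_scaleC
        cvs.scale_zero_left trig_step algebra_simps flip: scaleC_add_left
        cvs.scale_left_diff_distrib\<close>)
qed (simp_all add: clinear_iff op_simps scaleC_add_right scaleC_scaleC
      cvs.scale_right_diff_distrib algebra_simps)

private lemma z_w_square: "zop (zop v) + wop (wop v) = v"
proof -
  have "zop (zop v) + wop (wop v) = id v"
  proof (rule clinear_eq_on_basis[OF b _ cvs.linear_id, where A = "\<lambda>v. zop (zop v) + wop (wop v)"])
    fix j assume "j < n"
    moreover have "complex_of_real (sin (\<theta> j)) * of_real (sin (\<theta> j))
        + of_real (cos (\<theta> j)) * of_real (cos (\<theta> j)) = 1"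
      by (metis of_real_1 of_real_add of_real_mult power2_eq_square sin_cos_squared_add)
    ultimately show "zop (zop (b j)) + wop (wop (b j)) = id (b j)"
      by (simp add: zop_def wop_def op_basis op_simps scaleC_scaleC scaleC_one
          flip: scaleC_add_left)
  qed (simp add: clinear_iff op_simps scaleC_add_right)
  then show ?thesis by simp
qed

private lemma eval_plus: "free_eval ladder (fX + const \<i> * fY) = raise"
  and eval_minus: "free_eval ladder (fX - const \<i> * fY) = lower"
proof -
  have *: "cinner t (free_eval ladder (fX + const \<i> * fY) v) = cinner t (raise v)"
    "cinner t (free_eval ladder (fX - const \<i> * fY) v) = cinner t (lower v)" for t v
    unfolding eval_simps ladder_def gen.case cinner_simps by (rule half_sum_diff)+
  show "free_eval ladder (fX + const \<i> * fY) = raise"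
    by (rule ext, rule cinner_extensional, rule *(1))
  show "free_eval ladder (fX - const \<i> * fY) = lower"
    by (rule ext, rule cinner_extensional, rule *(2))
qed

private lemma eval_u: "free_eval ladder (fW R + const \<i> * fZ) = diag (\<lambda>j. cis (\<theta> j))"
proof
  fix v
  show "free_eval ladder (fW R + const \<i> * fZ) v = diag (\<lambda>j. cis (\<theta> j)) v"
  proof (rule diag_eqI[OF clinear_free_eval[OF linear_ladder]])
    fix j assume "j < n"
    moreover have "cis (\<theta> j) = of_real (cos (\<theta> j)) + \<i> * of_real (sin (\<theta> j))"
      by (simp add: complex_eq_iff)
    ultimately show "free_eval ladder (fW R + const \<i> * fZ) (b j) = scaleC (cis (\<theta> j)) (b j)"
      by (simp add: eval_simps eval_w ladder_def zop_def wop_def op_basis scaleC_scaleC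
          scaleC_add_left)
  qed
qed

private lemma adjoint_raise_lower: "adjoint_pair raise lower"
proof (rule adjoint_pair_on_basis[OF b linear_ops(1,2)])
  fix j k assume jk: "j < n" "k < n"
  \<comment> \<open>The ends are treated apart, since \<open>b n\<close> is no basis vector and
    \<open>0 - 1 = 0\<close> would pretend a match of indices. There one side vanishes by
    \<open>C_ends\<close>, the other by orthogonality or for the same reason.\<close>
  show "cinner (raise (b j)) (b k) = cinner (b j) (lower (b k))"
  proof (cases "Suc j = n \<or> k = 0")
    case True
    then show ?thesis using jk C_ends
      by (cases "Suc j = n"; cases "k = 0")
        (auto simp: op_basis cvs.scale_zero_left cinner_zero_left cinner_zero_right
          cinner_scaleC_left cinner_scaleC_right orthonormal_basis_cinner[OF b])
  next
    case False
    then show ?thesis using jk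
      by (cases k) (auto simp: op_basis cinner_scaleC_left cinner_scaleC_right
          orthonormal_basis_cinner[OF b])
  qed
qed

private lemma adjoint_ladder: "adjoint_pair (ladder g) (ladder g)"
proof -
  have rl: "cinner (raise v) w = cinner v (lower w)" "cinner (lower v) w = cinner v (raise w)" for v w
    using adjoint_raise_lower unfolding adjoint_pair_def by (blast, metis cinner_commute)
  have "adjoint_pair (ladder GZ) (ladder GZ)"
    by (rule adjoint_pair_on_basis[OF b linear_ladder linear_ladder])
      (simp add: ladder_def zop_def op_basis cinner_scaleC_left cinner_scaleC_right
        orthonormal_basis_cinner[OF b])
  then show ?thesis
    by (cases g) (simp_all add: adjoint_pair_def ladder_def cinner_simps cinner_add_left
        cinner_diff_left cinner_scaleC_left rl add.commute algebra_simps)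
qed

text \<open>Paired with a test vector \<open>t\<close>, each relator becomes a scalar expression in
  inner products. The relation for [x,y] is \<open>ladder_commutator\<close>; those for [y,z] and
  [z,x] are linear combinations of \<open>z_raise\<close> and \<open>z_lower\<close>.\<close>

private lemma ladder_relators:
  assumes "r \<in> relators R"
  shows "free_eval ladder r v = 0"
proof (rule cinner_extensional)
  fix t
  let ?e = "complex_of_real (tan (\<alpha> / 2))"
  have "1 + (tan (\<alpha> / 2))\<^sup>2 > 0" by (simp add: add_pos_nonneg)
  then have "complex_of_real (1 + (tan (\<alpha> / 2))\<^sup>2) \<noteq> 0" by (metis less_irrefl of_real_eq_0_iff)
  then have nz: "1 + ?e * ?e \<noteq> 0" by (simp add: power2_eq_square)
  \<comment> \<open>An abstract \<open>K\<close> keeps division out of the arithmetic: only its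
    defining equation enters, in the form \<open>inv\<close>.\<close>
  then obtain K where K: "K * (1 + ?e * ?e) = 1"
    and ladder_inv: "ladder GInv w = scaleC K w" for w
    using that[of "1 / (1 + ?e * ?e)"] by (simp add: ladder_def power2_eq_square)
  have inv: "K * x + ?e * (?e * (K * x)) = x" "K * (x + ?e * (?e * x)) = x" for x
    using K[THEN arg_cong, of "\<lambda>z. z * x"] by (simp_all add: algebra_simps)
  note red = ladder_def cinner_simps op_simps
  have comm: "cinner t (raise (lower v)) = cinner t (lower (raise v)) + 2 * ?e * cinner t (zop v)"
    using ladder_commutator[of v, THEN arg_cong, of "cinner t"]
    by (simp add: cinner_simps algebra_simps)
  have zr: "cinner t (zop (raise v)) = cinner t (raise (zop v))
      + ?e * (cinner t (wop (raise v)) + cinner t (raise (wop v)))"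
    using z_raise[of v, THEN arg_cong, of "cinner t"] by (simp add: cinner_simps)
  have zl: "cinner t (zop (lower v)) = cinner t (lower (zop v))
      - ?e * (cinner t (wop (lower v)) + cinner t (lower (wop v)))"
    using z_lower[of v, THEN arg_cong, of "cinner t"] by (simp add: cinner_simps)
  show "cinner t (free_eval ladder r v) = cinner t 0"
    using assms unfolding relators_def
  proof (elim UnE insertE emptyE CollectE exE conjE)
    fix g assume "r = fEps * var g - var g * fEps"
    then show ?thesis
      using clinear_simps(2)[OF linear_ladder, of g] by (simp add: eval_simps ladder_eps)
  next
    assume r: "r = (1 + fEps * fEps) * fInv - 1"
    show ?thesis unfolding r eval_simps ladder_eps ladder_inv cinner_simps
      by (simp only: inv diff_self)
  next
    assume r: "r = fInv * (1 + fEps * fEps) - 1"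
    show ?thesis unfolding r eval_simps ladder_eps ladder_inv cinner_simps
      by (simp only: inv diff_self)
  next
    assume r: "r = fX * fY - fY * fX - const \<i> * fEps * fZ"
    show ?thesis unfolding r eval_simps
      by (simp add: red comm algebra_simps add_divide_distrib diff_divide_distrib)
  next
    assume r: "r = fY * fZ - fZ * fY - const \<i> * fEps * (fW R * fX + fX * fW R)"
    show ?thesis unfolding r eval_simps eval_w
      by (simp add: red zr zl algebra_simps add_divide_distrib diff_divide_distrib)
  next
    assume r: "r = fZ * fX - fX * fZ - const \<i> * fEps * (fW R * fY + fY * fW R)"
    show ?thesis unfolding r eval_simps eval_w
      by (simp add: red zr zl algebra_simps add_divide_distrib diff_divide_distrib)
  next
    assume "r = fZ * fZ + fW R * fW R - 1"
    then show ?thesis by (simp add: eval_simps eval_w ladder_def z_w_square)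
  qed
qed

section \<open>Irreducibility, simple spectrum and existence\<close>

private lemmas quotient_cls = quotient_eval_cls[OF linear_ladder ladder_relators]

text \<open>Nonzero interior coefficients allow moving along the whole ladder inside
  \<open>S\<close>: down to \<open>b 0\<close>, then up again through all basis vectors.\<close>

private lemma irreducible:
  assumes S: "cvs.subspace S" "\<And>v. v \<in> S \<Longrightarrow> raise v \<in> S" "\<And>v. v \<in> S \<Longrightarrow> lower v \<in> S"
    and v: "v \<in> S" "v \<noteq> 0"
  shows "S = UNIV"
proof -
  have scaleS: "w \<in> S" if "scaleC c w \<in> S" "c \<noteq> 0" for c w
    using cvs.subspace_scale[OF S(1) that(1), of "1 / c"] that(2) by (simp add: scaleC_scaleC scaleC_one)
  \<comment> \<open>At \<open>j = n - 1\<close> the vector \<open>b n\<close> appears, with the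
    factor \<open>C n = 0\<close>.\<close>
  have coord: "cinner (b j) (lower w) = C (Suc j) * cinner (b (Suc j)) w" if "j < n" for j w
    using adjoint_raise_lower that unfolding adjoint_pair_def
    by (metis complex_cnj_cnj cinner_scaleC_left op_basis(1))
  \<comment> \<open>Repeated lowering turns the top nonzero component of a vector of \<open>S\<close> into a multiple of
    \<open>b 0\<close>.\<close>
  have "b 0 \<in> S"
    if "k \<le> n" "w \<in> S" "w \<noteq> 0" "\<And>j. k \<le> j \<Longrightarrow> j < n \<Longrightarrow> cinner (b j) w = 0" for k w
    using that
  proof (induction k arbitrary: w)
    case 0
    then have "w = 0" by (intro eqI_coordinates[OF b]) (simp add: cinner_zero_right)
    then show ?case using 0 by simp
  next
    case (Suc k)
    show ?case
    proof (cases "cinner (b k) w = 0")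
      case True
      have "cinner (b j) w = 0" if "k \<le> j" "j < n" for j
        using Suc.prems(4)[of j] True that by (cases "j = k") auto
      then show ?thesis using Suc by auto
    next
      case False
      show ?thesis
      proof (cases k)
        case 0
        have "w = scaleC (cinner (b 0) w) (b 0)"
          using Suc.prems(4) n 0
          by (intro eqI_coordinates[OF b])
            (auto simp: cinner_scaleC_right orthonormal_basis_cinner[OF b])
        then show ?thesis using scaleS[of "cinner (b 0) w" "b 0"] Suc.prems(2) False 0 by simp
      next
        case (Suc i)
        have "cinner (b i) (lower w) \<noteq> 0"
          using Suc \<open>Suc k \<le> n\<close> False C_nonzero[of k] by (simp add: coord)
        then have "lower w \<noteq> 0" by (auto simp: cinner_zero_right)
        moreover have "cinner (b j) (lower w) = 0" if "k \<le> j" "j < n" for j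
          using Suc.prems(4)[of "Suc j"] that C_ends by (cases "Suc j = n") (auto simp: coord)
        ultimately show ?thesis
          using Suc.IH[of "lower w"] Suc.prems(1,2) S(3) by auto
      qed
    qed
  qed
  from this[of n v] have "b 0 \<in> S" using v by auto
  have bS: "b j \<in> S" if "j < n" for j
    using that
  proof (induction j)
    case (Suc j)
    then have "scaleC (cnj (C (Suc j))) (b (Suc j)) \<in> S"
      using S(2)[of "b j"] by (simp add: op_basis)
    then show ?case by (rule scaleS) (use C_nonzero Suc in auto)
  qed (use \<open>b 0 \<in> S\<close> in simp)
  have "cvs.span (b ` {..<n}) \<subseteq> S"
    by (rule cvs.span_minimal) (use bS S(1) in auto)
  then show "S = UNIV" using b by (auto simp: orthonormal_basis_def)
qed

text \<open>An eigenvector for \<mu> has no component along \<open>b j\<close> unless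
  \<open>d j = \<mu>\<close>, and injectivity leaves at most one such index.\<close>

private lemma diag_eigenspace_dim:
  assumes "inj_on d {..<n}"
  shows "cvs.dim {v. diag d v = scaleC \<mu> v} \<le> 1"
proof -
  have coord: "cinner (b j) (diag d v) = d j * cinner (b j) v" if "j < n" for j v
  proof (rule clinear_eq_on_basis[OF b, where A = "\<lambda>v. cinner (b j) (diag d v)"
        and B = "\<lambda>v. d j * cinner (b j) v"])
    show "clinear (\<lambda>v. cinner (b j) (diag d v))" "clinear (\<lambda>v. d j * cinner (b j) v)"
      unfolding clinear_iff
      by (simp_all add: cinner_simps op_simps scaleC_complex_def algebra_simps)
  qed (use that in \<open>auto simp: op_basis cinner_scaleC_right orthonormal_basis_cinner[OF b]\<close>)
  have eig: "cinner (b j) v = 0" if "diag d v = scaleC \<mu> v" "d j \<noteq> \<mu>" "j < n" for v j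
    using coord[OF that(3), of v] that by (simp add: cinner_scaleC_right)
  \<comment> \<open>If no index satisfies \<open>d m = \<mu>\<close>, then \<open>m\<close> is
    arbitrary; the eigenspace is zero in that case and still lies in the span of
    \<open>b m\<close>.\<close>
  define m where "m = (SOME m. m < n \<and> d m = \<mu>)"
  have m: "j = m" if "j < n" "d j = \<mu>" for j
    using someI[of "\<lambda>m. m < n \<and> d m = \<mu>" j] that assms by (auto simp: m_def inj_on_def)
  have "{v. diag d v = scaleC \<mu> v} \<subseteq> cvs.span {b m}"
  proof
    fix v assume "v \<in> {v. diag d v = scaleC \<mu> v}"
    then have v: "diag d v = scaleC \<mu> v" by simp
    have "v = (\<Sum>j<n. scaleC (cinner (b j) v) (b j))" by (rule orthonormal_expansion[OF b])
    also have "\<dots> \<in> cvs.span {b m}"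
    proof (rule cvs.span_sum)
      fix j assume j: "j \<in> {..<n}"
      show "scaleC (cinner (b j) v) (b j) \<in> cvs.span {b m}"
      proof (cases "j = m")
        case True
        then show ?thesis by (simp add: cvs.span_scale cvs.span_base)
      next
        case False
        then have "cinner (b j) v = 0" using eig[OF v] m j by auto
        then show ?thesis by (simp add: cvs.scale_zero_left cvs.span_zero)
      qed
    qed
    finally show "v \<in> cvs.span {b m}" .
  qed
  from cvs.dim_le_card[OF this] show ?thesis by simp
qed

lemma S2_type_exists: "\<exists>\<Psi> :: free_alg set \<Rightarrow> 'h \<Rightarrow> 'h. S2_type R n \<alpha> \<beta> \<Psi>"
proof
  let ?\<Psi> = "quotient_eval ladder"
  have u: "?\<Psi> (elt_u R) = diag (\<lambda>j. cis (\<theta> j))"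
    and plus: "?\<Psi> (elt_a_plus R) = raise" and minus: "?\<Psi> (elt_a_minus R) = lower"
    by (simp_all add: elt_u_def elt_a_plus_def elt_a_minus_def quotient_cls eval_u
        eval_plus eval_minus)
  have inj: "inj_on (\<lambda>j. cis (\<theta> j)) {..<n}"
    using cis_arithmetic_progression_inj[OF \<alpha>(1,3)] by (auto simp: inj_on_def \<theta>_def)
  have "S = {0} \<or> S = UNIV" if "invariant_subspace R ?\<Psi> S" for S
  proof (cases "S = {0}")
    case False
    have S: "cvs.subspace S" "\<And>p v. v \<in> S \<Longrightarrow> ?\<Psi> (cls R p) v \<in> S"
      using that by (auto simp: invariant_subspace_def carrier_alg)
    then obtain v where v: "v \<in> S" "v \<noteq> 0" using False cvs.subspace_0[OF S(1)] by auto
    have "S = UNIV"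
    proof (rule irreducible[OF S(1) _ _ v])
      show "raise w \<in> S" "lower w \<in> S" if "w \<in> S" for w
        using S(2)[OF that] plus minus unfolding elt_a_plus_def elt_a_minus_def by metis+
    qed
    then show ?thesis ..
  qed simp
  moreover have "adjoint_pair (?\<Psi> (cls R p)) (?\<Psi> (dagger (cls R p)))" for p
    using free_eval_adjoint[OF linear_ladder adjoint_ladder] by (simp add: dagger_cls quotient_cls)
  moreover have "(UNIV :: 'h set) \<noteq> {0}"
    using orthonormal_basis_nonzero[OF b n] by auto
  moreover have "0 < tan (\<alpha> / 2)" using \<alpha> by (intro tan_gt_zero) auto
  moreover have "?\<Psi> (elt_eps R) v = scaleC (of_real (tan (\<alpha> / 2))) v" for v
    by (simp add: elt_eps_def quotient_cls free_eval_var ladder_def)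
  ultimately have adm: "admissible_rep R ?\<Psi> (tan (\<alpha> / 2))"
    unfolding admissible_rep_def carrier_alg
    using quotient_eval_hom[OF linear_ladder ladder_relators] diag_eigenspace_dim[OF inj]
    by (auto simp: u scal_cls quotient_cls eval_simps)
  have "cvs.dim (UNIV :: 'h set) = n"
    using cvs.dim_eq_card[of "b ` {..<n}" UNIV] orthonormal_independent[of n b] b
    by (simp add: orthonormal_basis_def card_image)
  moreover have "?\<Psi> (elt_a_plus R) (b (n - 1)) = 0" "?\<Psi> (elt_a_minus R) (b 0) = 0"
    using n C_ends by (simp_all add: plus minus op_basis cvs.scale_zero_left)
  ultimately show "S2_type R n \<alpha> \<beta> ?\<Psi>"
    unfolding S2_type_def
    using adm \<alpha> b C_norm C_nonzero C_ends n
    by (intro conjI exI[of _ b] exI[of _ C])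
      (auto simp: u plus minus op_basis \<theta>_def)
qed

end

section \<open>Parameters and uniqueness\<close>

lemma S2_typeE:
  fixes \<Psi> :: "free_alg set \<Rightarrow> 'h::complex_inner \<Rightarrow> 'h"
  assumes "S2_type R n \<alpha> \<beta> \<Psi>"
  obtains b :: "nat \<Rightarrow> 'h::complex_inner" and C :: "nat \<Rightarrow> complex" where
    "orthonormal_basis n b"
    "\<And>m. m \<le> n \<Longrightarrow> (cmod (C m))\<^sup>2 = (1 / cos (\<alpha> / 2)) * cos (\<beta> - \<alpha> / 2 + real m * \<alpha>) + R"
    "\<And>m. 1 \<le> m \<Longrightarrow> m < n \<Longrightarrow> C m \<noteq> 0" "C 0 = 0" "C n = 0"
    "\<And>m. m < n \<Longrightarrow> \<Psi> (elt_u R) (b m) = scaleC (cis (\<beta> + real m * \<alpha>)) (b m)"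
    "\<And>m. 1 \<le> m \<Longrightarrow> m < n \<Longrightarrow> \<Psi> (elt_a_minus R) (b m) = scaleC (C m) (b (m - 1))"
    "\<And>m. m + 1 < n \<Longrightarrow> \<Psi> (elt_a_plus R) (b m) = scaleC (cnj (C (m + 1))) (b (m + 1))"
    "\<Psi> (elt_a_minus R) (b 0) = 0" "\<Psi> (elt_a_plus R) (b (n - 1)) = 0"
  using assms unfolding S2_type_def by blast

lemma S2_type_admissible:
  assumes "S2_type R n \<alpha> \<beta> \<Psi>"
  shows "0 < \<alpha>" "\<alpha> < pi" "admissible_rep R \<Psi> (tan (\<alpha> / 2))"
  using assms by (simp_all add: S2_type_def)

text \<open>\<beta> enters only through cos and cis, both of period 2\<pi>.\<close>

lemma S2_type_shift:
  assumes "S2_type R n \<alpha> \<beta> \<Psi>"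
  shows "S2_type R n \<alpha> (\<beta> + 2 * pi * of_int k) \<Psi>"
proof -
  have "cos (\<beta> + 2 * pi * of_int k - \<alpha> / 2 + real m * \<alpha>) = cos (\<beta> - \<alpha> / 2 + real m * \<alpha>)"
    "cis (\<beta> + 2 * pi * of_int k + real m * \<alpha>) = cis (\<beta> + real m * \<alpha>)" for m
  proof -
    have per: "cis (x + 2 * pi * of_int k) = cis x" for x
      by (simp add: cis_multiple_2pi flip: cis_mult)
    have "\<beta> + 2 * pi * of_int k - \<alpha> / 2 + real m * \<alpha>
        = (\<beta> - \<alpha> / 2 + real m * \<alpha>) + 2 * pi * of_int k"
      "\<beta> + 2 * pi * of_int k + real m * \<alpha> = (\<beta> + real m * \<alpha>) + 2 * pi * of_int k"
      by simp_all
    then show "cos (\<beta> + 2 * pi * of_int k - \<alpha> / 2 + real m * \<alpha>) = cos (\<beta> - \<alpha> / 2 + real m * \<alpha>)"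
      "cis (\<beta> + 2 * pi * of_int k + real m * \<alpha>) = cis (\<beta> + real m * \<alpha>)"
      by (metis cis.simps(1) per)+
  qed
  then show ?thesis using assms unfolding S2_type_def by presburger
qed

lemma S2_type_normalise:
  assumes "S2_type R n \<alpha> \<beta> \<Psi>"
  obtains \<beta>' where "S2_type R n \<alpha> \<beta>' \<Psi>" "- 2 * pi < \<beta>' - \<alpha> / 2" "\<beta>' - \<alpha> / 2 \<le> 0"
proof
  \<comment> \<open>The quantity \<beta> - \<alpha>/2 measured in full turns. Rounding up leaves a
    remainder in (-1, 0], which matches the half-open normalisation.\<close>
  define q where "q = (\<beta> - \<alpha> / 2) / (2 * pi)"
  then have q: "2 * pi * q = \<beta> - \<alpha> / 2" by simp
  let ?\<beta> = "\<beta> + 2 * pi * of_int (- \<lceil>q\<rceil>)"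
  show "S2_type R n \<alpha> ?\<beta> \<Psi>" using assms by (rule S2_type_shift)
  have eq: "?\<beta> - \<alpha> / 2 = 2 * pi * (q - of_int \<lceil>q\<rceil>)" by (simp add: right_diff_distrib q)
  show "?\<beta> - \<alpha> / 2 \<le> 0" unfolding eq by (intro mult_nonneg_nonpos) auto
  have "2 * pi * (- 1) < 2 * pi * (q - of_int \<lceil>q\<rceil>)"
    using ceiling_correct[of q] by (intro mult_strict_left_mono) auto
  then show "- 2 * pi < ?\<beta> - \<alpha> / 2" unfolding eq by simp
qed

text \<open>Multiplied by cos(\<alpha>/2) > 0, the norm formula turns \<open>C 0 = 0\<close> and
  \<open>C n = 0\<close> into the end equations of \<open>ladder_parameters\<close>, and
  \<open>C 1 \<noteq> 0\<close> into its strict inequality. Index 1 is interior because n \<ge>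
  2.\<close>

lemma S2_type_parameters:
  assumes S: "S2_type R n \<alpha> \<beta> \<Psi>" and n: "2 \<le> n" and \<alpha>: "real n * \<alpha> < 2 * pi"
    and \<beta>: "- 2 * pi < \<beta> - \<alpha> / 2" "\<beta> - \<alpha> / 2 \<le> 0"
  shows "cos (real n * \<alpha> / 2) + R * cos (\<alpha> / 2) = 0" "\<beta> - \<alpha> / 2 = - (real n * \<alpha> / 2)"
proof -
  obtain C where C: "\<And>m. m \<le> n \<Longrightarrow>
        (cmod (C m))\<^sup>2 = (1 / cos (\<alpha> / 2)) * cos (\<beta> - \<alpha> / 2 + real m * \<alpha>) + R"
      "\<And>m. 1 \<le> m \<Longrightarrow> m < n \<Longrightarrow> C m \<noteq> 0" "C 0 = 0" "C n = 0"
    by (rule S2_typeE[OF S], rule that)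
  have a: "0 < \<alpha>" "\<alpha> < pi" using S2_type_admissible[OF S] by auto
  then have c: "0 < cos (\<alpha> / 2)" by (intro cos_gt_zero_pi) auto
  have m: "cos (\<beta> - \<alpha> / 2 + real m * \<alpha>) = (cmod (C m))\<^sup>2 * cos (\<alpha> / 2) - R * cos (\<alpha> / 2)"
    if "m \<le> n" for m
    unfolding C(1)[OF that] using c by (simp add: field_simps)
  have e0: "cos (\<beta> - \<alpha> / 2) = - R * cos (\<alpha> / 2)" using m[of 0] C(3) by simp
  have en: "cos (\<beta> - \<alpha> / 2 + real n * \<alpha>) = - R * cos (\<alpha> / 2)" using m[of n] C(4) by simp
  have "0 < (cmod (C 1))\<^sup>2 * cos (\<alpha> / 2)" using C(2)[of 1] n c by simp
  then have "- R * cos (\<alpha> / 2) < cos (\<beta> - \<alpha> / 2 + \<alpha>)" using m[of 1] n by simp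
  from ladder_parameters[OF n a(1) \<alpha> \<beta> e0 en this]
  show eq: "\<beta> - \<alpha> / 2 = - (real n * \<alpha> / 2)" .
  show "cos (real n * \<alpha> / 2) + R * cos (\<alpha> / 2) = 0" using e0 unfolding eq by simp
qed

text \<open>\<epsilon> acts by the scalar tan(\<alpha>/2), and tan is injective on (0, \<pi>/2). So
  the angle depends on \<Psi> alone, even when n\<alpha> < 2\<pi> is not known for both sets of
  parameters.\<close>

lemma S2_type_angle_unique:
  assumes S: "S2_type R n \<alpha> \<beta> (\<Psi> :: free_alg set \<Rightarrow> 'h::complex_inner \<Rightarrow> 'h)" "S2_type R n \<alpha>' \<beta>' \<Psi>"
  shows "\<alpha> = \<alpha>'"
proof -
  note adm = S2_type_admissible[OF S(1)] S2_type_admissible[OF S(2)]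
  obtain v :: 'h where v: "v \<noteq> 0" using adm(3) by (auto simp: admissible_rep_def)
  have "scaleC (of_real (tan (\<alpha> / 2))) v = scaleC (of_real (tan (\<alpha>' / 2))) v"
    using adm(3,6) unfolding admissible_rep_def by metis
  then have "complex_of_real (tan (\<alpha> / 2)) = of_real (tan (\<alpha>' / 2))"
    using v cvs.scale_right_imp_eq by blast
  then have "tan (\<alpha> / 2) = tan (\<alpha>' / 2)" by (simp only: of_real_eq_iff)
  moreover have "arctan (tan (x / 2)) = x / 2" if "0 < x" "x < pi" for x :: real
    using that pi_gt_zero by (intro arctan_tan) linarith+
  ultimately have "\<alpha> / 2 = \<alpha>' / 2" using adm(1,2,4,5) by metis
  then show ?thesis by simp
qed

lemma S2_type_unitarily_equivalent:
  fixes \<Psi> :: "free_alg set \<Rightarrow> 'h::complex_inner \<Rightarrow> 'h" and \<Phi> :: "free_alg set \<Rightarrow> 'k::complex_inner \<Rightarrow> 'k"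
  assumes \<Psi>: "S2_type R n \<alpha> \<beta> \<Psi>" and \<Phi>: "S2_type R n \<alpha> \<beta> \<Phi>"
  shows "unitarily_equivalent R \<Psi> \<Phi>"
proof -
  obtain b C where b: "orthonormal_basis n b" and C: "\<And>m. m \<le> n \<Longrightarrow>
        (cmod (C m))\<^sup>2 = (1 / cos (\<alpha> / 2)) * cos (\<beta> - \<alpha> / 2 + real m * \<alpha>) + R"
      "\<And>m. 1 \<le> m \<Longrightarrow> m < n \<Longrightarrow> C m \<noteq> 0" "C 0 = 0" "C n = 0"
    and \<Psi>b: "\<And>m. m < n \<Longrightarrow> \<Psi> (elt_u R) (b m) = scaleC (cis (\<beta> + real m * \<alpha>)) (b m)"
    "\<And>m. 1 \<le> m \<Longrightarrow> m < n \<Longrightarrow> \<Psi> (elt_a_minus R) (b m) = scaleC (C m) (b (m - 1))"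
    "\<And>m. m + 1 < n \<Longrightarrow> \<Psi> (elt_a_plus R) (b m) = scaleC (cnj (C (m + 1))) (b (m + 1))"
    "\<Psi> (elt_a_minus R) (b 0) = 0" "\<Psi> (elt_a_plus R) (b (n - 1)) = 0"
    by (rule S2_typeE[OF \<Psi>], rule that)
  obtain g D where g: "orthonormal_basis n g" and D: "\<And>m. m \<le> n \<Longrightarrow>
        (cmod (D m))\<^sup>2 = (1 / cos (\<alpha> / 2)) * cos (\<beta> - \<alpha> / 2 + real m * \<alpha>) + R"
      "\<And>m. 1 \<le> m \<Longrightarrow> m < n \<Longrightarrow> D m \<noteq> 0" "D 0 = 0" "D n = 0"
    and \<Phi>g: "\<And>m. m < n \<Longrightarrow> \<Phi> (elt_u R) (g m) = scaleC (cis (\<beta> + real m * \<alpha>)) (g m)"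
    "\<And>m. 1 \<le> m \<Longrightarrow> m < n \<Longrightarrow> \<Phi> (elt_a_minus R) (g m) = scaleC (D m) (g (m - 1))"
    "\<And>m. m + 1 < n \<Longrightarrow> \<Phi> (elt_a_plus R) (g m) = scaleC (cnj (D (m + 1))) (g (m + 1))"
    "\<Phi> (elt_a_minus R) (g 0) = 0" "\<Phi> (elt_a_plus R) (g (n - 1)) = 0"
    by (rule S2_typeE[OF \<Phi>], rule that)
  have norm_sq: "(cmod (C m))\<^sup>2 = (cmod (D m))\<^sup>2" if "m \<le> n" for m
    using C(1)[OF that] D(1)[OF that] by simp
  then have norm_eq: "cmod (C m) = cmod (D m)" if "m \<le> n" for m
    using that by (metis norm_ge_zero power2_eq_imp_eq)
  \<comment> \<open>Phases making the diagonal map intertwine the lowering operators; since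
    \<open>cmod (C m) = cmod (D m)\<close>, they also intertwine the raising operators.\<close>
  define p where "p m = (\<Prod>k<m. C (Suc k) / D (Suc k))" for m
  have p_minus: "D (Suc m) * p (Suc m) = p m * C (Suc m)" if "Suc m < n" for m
    using D(2)[of "Suc m"] that by (simp add: p_def)
  have p_plus: "p (Suc m) * cnj (C (Suc m)) = p m * cnj (D (Suc m))" if "Suc m < n" for m
  proof -
    have "C (Suc m) * cnj (C (Suc m)) = D (Suc m) * cnj (D (Suc m))"
      using norm_sq[of "Suc m"] that by (simp flip: complex_norm_square)
    moreover have "p (Suc m) * cnj (C (Suc m)) = p m * (C (Suc m) * cnj (C (Suc m))) / D (Suc m)"
      by (simp add: p_def)
    ultimately show ?thesis using D(2)[of "Suc m"] that by simp
  qed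
  \<comment> \<open>The factors have indices \<open>Suc k\<close> with k < m < n, hence interior, so
    no denominator is 0 and each quotient has modulus 1.\<close>
  have p_norm: "cmod (p m) = 1" if "m < n" for m
    unfolding p_def prod_norm[symmetric]
    by (rule prod.neutral) (use norm_eq D(2) that in \<open>auto simp: norm_divide\<close>)
  define T where "T = basis_map n b (\<lambda>j. scaleC (p j) (g j))"
  have T: "unitary_map T" unfolding T_def by (rule unitary_basis_map[OF b g p_norm])
  then have linT: "clinear T" by (simp add: unitary_map_def)
  have Tb: "T (b j) = scaleC (p j) (g j)" if "j < n" for j
    unfolding T_def by (rule basis_map_basis[OF b that])
  note a\<Psi> = admissible_action[OF S2_type_admissible(3)[OF \<Psi>]]
    and a\<Phi> = admissible_action[OF S2_type_admissible(3)[OF \<Phi>]]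
  note lin = clinear_simps[OF linT] clinear_simps[OF clinear_action[OF a\<Psi>]]
    clinear_simps[OF clinear_action[OF a\<Phi>]]
  \<comment> \<open>Linearity reduces the intertwining property to basis vectors. It is phrased for
    \<open>cls R q\<close>, so u, a_minus and a_plus are unfolded below to match it.\<close>
  have ext: "T (\<Psi> (cls R q) v) = \<Phi> (cls R q) (T v)"
    if "\<And>j. j < n \<Longrightarrow> T (\<Psi> (cls R q) (b j)) = \<Phi> (cls R q) (T (b j))" for q v
    by (rule clinear_eq_on_basis[OF b, where A = "\<lambda>v. T (\<Psi> (cls R q) v)"
          and B = "\<lambda>v. \<Phi> (cls R q) (T v)"])
      (simp_all add: clinear_iff lin that)
  have u: "T (\<Psi> (elt_u R) v) = \<Phi> (elt_u R) (T v)" for v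
    unfolding elt_u_def
  proof (rule ext, fold elt_u_def)
    have linu: "\<Phi> (elt_u R) (scaleC c w) = scaleC c (\<Phi> (elt_u R) w)" for c w
      unfolding elt_u_def by (simp add: lin)
    fix j assume "j < n"
    then show "T (\<Psi> (elt_u R) (b j)) = \<Phi> (elt_u R) (T (b j))"
      by (simp add: \<Psi>b \<Phi>g Tb lin linu scaleC_scaleC mult.commute)
  qed
  have minus: "T (\<Psi> (elt_a_minus R) v) = \<Phi> (elt_a_minus R) (T v)" for v
    unfolding elt_a_minus_def
  proof (rule ext, fold elt_a_minus_def)
    have linm: "\<Phi> (elt_a_minus R) (scaleC c w) = scaleC c (\<Phi> (elt_a_minus R) w)" for c w
      unfolding elt_a_minus_def by (simp add: lin)
    fix j assume "j < n"
    then show "T (\<Psi> (elt_a_minus R) (b j)) = \<Phi> (elt_a_minus R) (T (b j))"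
      by (cases j) (simp_all add: \<Psi>b \<Phi>g Tb lin linm scaleC_scaleC mult.commute p_minus)
  qed
  have plus: "T (\<Psi> (elt_a_plus R) v) = \<Phi> (elt_a_plus R) (T v)" for v
    unfolding elt_a_plus_def
  proof (rule ext, fold elt_a_plus_def)
    have linp: "\<Phi> (elt_a_plus R) (scaleC c w) = scaleC c (\<Phi> (elt_a_plus R) w)" for c w
      unfolding elt_a_plus_def by (simp add: lin)
    fix j assume j: "j < n"
    show "T (\<Psi> (elt_a_plus R) (b j)) = \<Phi> (elt_a_plus R) (T (b j))"
    proof (cases "Suc j = n")
      case True
      then have "j = n - 1" by simp
      then have "\<Psi> (elt_a_plus R) (b j) = 0" "\<Phi> (elt_a_plus R) (g j) = 0"
        using \<Psi>b(5) \<Phi>g(5) by simp_all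
      then show ?thesis using j by (simp add: Tb lin linp)
    next
      case False
      with j have "Suc j < n" by simp
      then show ?thesis using j \<Psi>b(3)[of j] \<Phi>g(3)[of j] p_plus[of j]
        by (simp add: Tb lin linp scaleC_scaleC mult.commute)
    qed
  qed
  have "\<Psi> (elt_eps R) v = scaleC (of_real (tan (\<alpha> / 2))) v"
    "\<Phi> (elt_eps R) w = scaleC (of_real (tan (\<alpha> / 2))) w" for v w
    using S2_type_admissible(3)[OF \<Psi>] S2_type_admissible(3)[OF \<Phi>]
    by (simp_all add: admissible_rep_def)
  from intertwinesI[OF a\<Psi> this(1) a\<Phi> this(2) linT u plus minus]
  show ?thesis unfolding unitarily_equivalent_def carrier_alg using T by blast
qed

text \<open>The points m\<alpha> - n\<alpha>/2 are symmetric about 0, and the root equation says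
  that R cancels the cosine term at both ends. Interior points are closer to 0, so strict
  monotonicity of cos on [0, \<pi>] makes the interior squared norms positive.\<close>

lemma minimal_S2_rep_exists:
  assumes n: "2 \<le> n" and dim: "cvs.dim (UNIV :: 'h::complex_inner set) = n"
    and \<alpha>: "0 < \<alpha>" "\<alpha> < 2 * pi / real n" and root: "cos (real n * \<alpha> / 2) + R * cos (\<alpha> / 2) = 0"
  shows "\<exists>\<Psi> :: free_alg set \<Rightarrow> 'h \<Rightarrow> 'h. minimal_S2_rep R n \<Psi>"
proof -
  obtain b :: "nat \<Rightarrow> 'h" where b: "orthonormal_basis n b"
    using orthonormal_basis_exists[OF dim] n by auto
  let ?t = "\<lambda>m. real m * \<alpha> - real n * \<alpha> / 2"
  \<comment> \<open>Only the moduli are prescribed; real square roots are one choice of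
    phases.\<close>
  define C where "C m = complex_of_real (sqrt (1 / cos (\<alpha> / 2) * cos (?t m) + R))" for m
  have na: "real n * \<alpha> < 2 * pi" using \<alpha> n by (simp add: pos_less_divide_eq mult.commute)
  have "2 * \<alpha> \<le> real n * \<alpha>" using n \<alpha> by (intro mult_right_mono) auto
  then have "\<alpha> < pi" using na by linarith
  then have c: "0 < cos (\<alpha> / 2)" using \<alpha>(1) by (intro cos_gt_zero_pi) auto
  have "R * cos (\<alpha> / 2) = - cos (real n * \<alpha> / 2)" using root by linarith
  then have R: "R = - cos (real n * \<alpha> / 2) / cos (\<alpha> / 2)" using c by (metis less_irrefl nonzero_eq_divide_eq)
  have val: "1 / cos (\<alpha> / 2) * cos (?t m) + R
      = (cos \<bar>?t m\<bar> - cos (real n * \<alpha> / 2)) / cos (\<alpha> / 2)" for m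
    unfolding R by (simp add: diff_divide_distrib)
  have pos: "0 < 1 / cos (\<alpha> / 2) * cos (?t m) + R" if "1 \<le> m" "m < n" for m
  proof -
    have "0 < real m * \<alpha>" "real m * \<alpha> < real n * \<alpha>" using that \<alpha> by auto
    then have "\<bar>?t m\<bar> < real n * \<alpha> / 2" by linarith
    then have "cos (real n * \<alpha> / 2) < cos \<bar>?t m\<bar>"
      using na by (intro cos_monotone_0_pi) auto
    then show ?thesis unfolding val using c by simp
  qed
  have ends: "1 / cos (\<alpha> / 2) * cos (?t 0) + R = 0" "1 / cos (\<alpha> / 2) * cos (?t n) + R = 0"
  proof -
    have "?t n = real n * \<alpha> / 2" by simp
    then have tn: "cos (?t n) = cos (real n * \<alpha> / 2)" by (rule arg_cong)
    have t0: "cos (?t 0) = cos (real n * \<alpha> / 2)" by simp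
    show "1 / cos (\<alpha> / 2) * cos (?t 0) + R = 0" "1 / cos (\<alpha> / 2) * cos (?t n) + R = 0"
      unfolding t0 tn unfolding R by simp_all
  qed
  have nonneg: "0 \<le> 1 / cos (\<alpha> / 2) * cos (?t m) + R" if "m \<le> n" for m
    using pos[of m] ends that by (cases "m = 0 \<or> m = n") (auto intro: less_imp_le)
  \<comment> \<open>Chosen so that \<beta> - \<alpha>/2 = - n\<alpha>/2, which puts the coefficients
    at the angles \<open>?t m\<close>.\<close>
  let ?\<beta> = "\<alpha> / 2 - real n * \<alpha> / 2"
  have "\<exists>\<Psi> :: free_alg set \<Rightarrow> 'h \<Rightarrow> 'h. S2_type R n \<alpha> ?\<beta> \<Psi>"
  proof (rule S2_type_exists[OF b _ \<alpha>(1) \<open>\<alpha> < pi\<close> na])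
    fix m assume "m \<le> n"
    have arg: "?\<beta> - \<alpha> / 2 + real m * \<alpha> = ?t m" by simp
    show "(cmod (C m))\<^sup>2 = 1 / cos (\<alpha> / 2) * cos (?\<beta> - \<alpha> / 2 + real m * \<alpha>) + R"
      unfolding arg C_def norm_of_real using nonneg[OF \<open>m \<le> n\<close>] by simp
  next
    fix m assume "1 \<le> m" "m < n"
    with pos[of m] show "C m \<noteq> 0" unfolding C_def by (metis less_irrefl of_real_eq_0_iff real_sqrt_eq_0_iff)
  next
    show "C 0 = 0" "C n = 0" unfolding C_def ends by simp_all
  qed (use n in simp)
  then show ?thesis using na by (auto simp: minimal_S2_rep_def)
qed

lemma minimal_parameters:
  assumes "minimal_S2_rep R n \<Psi>" and n: "2 \<le> n"
  obtains \<alpha> \<beta> where "S2_type R n \<alpha> \<beta> \<Psi>" "- 2 * pi < \<beta> - \<alpha> / 2" "\<beta> - \<alpha> / 2 \<le> 0"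
    "0 < \<alpha>" "\<alpha> < 2 * pi / real n" "real n * \<alpha> < 2 * pi"
    "cos (real n * \<alpha> / 2) + R * cos (\<alpha> / 2) = 0" "\<beta> - \<alpha> / 2 = - (real n * \<alpha> / 2)"
proof -
  obtain \<alpha> \<beta> where "S2_type R n \<alpha> \<beta> \<Psi>" and na: "real n * \<alpha> < 2 * pi"
    using assms(1) by (auto simp: minimal_S2_rep_def)
  then obtain \<beta>' where S: "S2_type R n \<alpha> \<beta>' \<Psi>" "- 2 * pi < \<beta>' - \<alpha> / 2" "\<beta>' - \<alpha> / 2 \<le> 0"
    using S2_type_normalise by blast
  have "\<alpha> < 2 * pi / real n" using n na by (simp add: pos_less_divide_eq mult.commute)
  with that[OF S S2_type_admissible(1)[OF S(1)] _ na] S2_type_parameters[OF S(1) n na S(2,3)]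
  show ?thesis by blast
qed

lemma angle_unique:
  assumes n: "2 \<le> n"
    and "0 < \<alpha>" "\<alpha> < 2 * pi / real n" "cos (real n * \<alpha> / 2) + R * cos (\<alpha> / 2) = 0"
    and "0 < \<alpha>'" "\<alpha>' < 2 * pi / real n" "cos (real n * \<alpha>' / 2) + R * cos (\<alpha>' / 2) = 0"
  shows "\<alpha> = \<alpha>'"
  using ladder_root_unique[OF n, of "\<alpha> / 2" "\<alpha>' / 2" R] assms by (auto simp: mult.commute[of 2])

text \<open>The second type \<open>'k\<close> lets uniqueness compare representations on different
  spaces of the same dimension.\<close>

theorem lemma5:
  fixes R :: real and n :: nat
  assumes "n \<ge> 2"
    and "cvs.dim (UNIV :: 'h::complex_inner set) = n"
    and "cvs.dim (UNIV :: 'k::complex_inner set) = n"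
  shows "((\<exists>\<Psi> :: free_alg set \<Rightarrow> 'h \<Rightarrow> 'h. minimal_S2_rep R n \<Psi>) \<longleftrightarrow>
            - 1 < R \<and> (n = 2 \<or> R < 1 / cos (pi / real n))) \<and>
         (- 1 < R \<and> (n = 2 \<or> R < 1 / cos (pi / real n)) \<longrightarrow>
            (\<forall>(\<Psi> :: free_alg set \<Rightarrow> 'h \<Rightarrow> 'h) (\<Phi> :: free_alg set \<Rightarrow> 'k \<Rightarrow> 'k).
               minimal_S2_rep R n \<Psi> \<and> minimal_S2_rep R n \<Phi> \<longrightarrow>
               unitarily_equivalent R \<Psi> \<Phi>) \<and>
            (\<forall>\<Psi> :: free_alg set \<Rightarrow> 'h \<Rightarrow> 'h. minimal_S2_rep R n \<Psi> \<longrightarrow>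
               (\<exists>\<alpha> \<beta>. S2_type R n \<alpha> \<beta> \<Psi> \<and>
                  - 2 * pi < \<beta> - \<alpha> / 2 \<and> \<beta> - \<alpha> / 2 \<le> 0) \<and>
               (\<forall>\<alpha> \<beta>.
                  S2_type R n \<alpha> \<beta> \<Psi> \<and> - 2 * pi < \<beta> - \<alpha> / 2 \<and> \<beta> - \<alpha> / 2 \<le> 0 \<longleftrightarrow>
                  cos (real n * \<alpha> / 2) + R * cos (\<alpha> / 2) = 0 \<and>
                  0 < \<alpha> \<and> \<alpha> < 2 * pi / real n \<and>
                  \<beta> - \<alpha> / 2 = - (real n * \<alpha> / 2))))"
proof (intro conjI impI allI)
  note n = assms(1)
  have range: "- 1 < R \<and> (n = 2 \<or> R < 1 / cos (pi / real n)) \<longleftrightarrow>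
      (\<exists>\<alpha>. 0 < \<alpha> \<and> \<alpha> < 2 * pi / real n \<and> cos (real n * \<alpha> / 2) + R * cos (\<alpha> / 2) = 0)"
    unfolding ladder_root_iff[OF n, symmetric]
  proof
    assume "\<exists>t. 0 < t \<and> t < pi / real n \<and> cos (real n * t) + R * cos t = 0"
    then obtain t where "0 < t \<and> t < pi / real n \<and> cos (real n * t) + R * cos t = 0" ..
    then show "\<exists>\<alpha>. 0 < \<alpha> \<and> \<alpha> < 2 * pi / real n \<and> cos (real n * \<alpha> / 2) + R * cos (\<alpha> / 2) = 0"
      by (intro exI[of _ "2 * t"]) auto
  next
    assume "\<exists>\<alpha>. 0 < \<alpha> \<and> \<alpha> < 2 * pi / real n \<and> cos (real n * \<alpha> / 2) + R * cos (\<alpha> / 2) = 0"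
    then obtain \<alpha> where
      "0 < \<alpha> \<and> \<alpha> < 2 * pi / real n \<and> cos (real n * \<alpha> / 2) + R * cos (\<alpha> / 2) = 0" ..
    then show "\<exists>t. 0 < t \<and> t < pi / real n \<and> cos (real n * t) + R * cos t = 0"
      by (intro exI[of _ "\<alpha> / 2"]) (auto simp: mult.commute[of 2])
  qed
  show "(\<exists>\<Psi> :: free_alg set \<Rightarrow> 'h \<Rightarrow> 'h. minimal_S2_rep R n \<Psi>) \<longleftrightarrow>
      - 1 < R \<and> (n = 2 \<or> R < 1 / cos (pi / real n))"
    unfolding range
  proof
    assume "\<exists>\<Psi> :: free_alg set \<Rightarrow> 'h \<Rightarrow> 'h. minimal_S2_rep R n \<Psi>"
    then obtain \<Psi> :: "free_alg set \<Rightarrow> 'h \<Rightarrow> 'h" where "minimal_S2_rep R n \<Psi>" ..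
    then show "\<exists>\<alpha>. 0 < \<alpha> \<and> \<alpha> < 2 * pi / real n \<and> cos (real n * \<alpha> / 2) + R * cos (\<alpha> / 2) = 0"
      using minimal_parameters[OF _ n] by metis
  qed (use minimal_S2_rep_exists[OF n assms(2)] in blast)
  show "unitarily_equivalent R \<Psi> \<Phi>" if min: "minimal_S2_rep R n \<Psi> \<and> minimal_S2_rep R n \<Phi>"
    for \<Psi> :: "free_alg set \<Rightarrow> 'h \<Rightarrow> 'h" and \<Phi> :: "free_alg set \<Rightarrow> 'k \<Rightarrow> 'k"
  proof -
    obtain \<alpha> \<beta> where P: "S2_type R n \<alpha> \<beta> \<Psi>" "0 < \<alpha>" "\<alpha> < 2 * pi / real n"
      "cos (real n * \<alpha> / 2) + R * cos (\<alpha> / 2) = 0" "\<beta> - \<alpha> / 2 = - (real n * \<alpha> / 2)"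
      by (rule minimal_parameters[OF conjunct1[OF min] n], rule that)
    obtain \<alpha>' \<beta>' where Q: "S2_type R n \<alpha>' \<beta>' \<Phi>" "0 < \<alpha>'" "\<alpha>' < 2 * pi / real n"
      "cos (real n * \<alpha>' / 2) + R * cos (\<alpha>' / 2) = 0" "\<beta>' - \<alpha>' / 2 = - (real n * \<alpha>' / 2)"
      by (rule minimal_parameters[OF conjunct2[OF min] n], rule that)
    have "\<alpha> = \<alpha>'" by (rule angle_unique[OF n P(2-4) Q(2-4)])
    with P(5) Q(5) have "\<beta> = \<beta>'" by simp
    show ?thesis
      using S2_type_unitarily_equivalent P(1) Q(1) unfolding \<open>\<alpha> = \<alpha>'\<close> \<open>\<beta> = \<beta>'\<close> by blast
  qed
  fix \<Psi> :: "free_alg set \<Rightarrow> 'h \<Rightarrow> 'h"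
  assume min: "minimal_S2_rep R n \<Psi>"
  obtain \<alpha>\<^sub>0 \<beta>\<^sub>0 where P: "S2_type R n \<alpha>\<^sub>0 \<beta>\<^sub>0 \<Psi>" "- 2 * pi < \<beta>\<^sub>0 - \<alpha>\<^sub>0 / 2" "\<beta>\<^sub>0 - \<alpha>\<^sub>0 / 2 \<le> 0"
    "0 < \<alpha>\<^sub>0" "\<alpha>\<^sub>0 < 2 * pi / real n" "real n * \<alpha>\<^sub>0 < 2 * pi"
    "cos (real n * \<alpha>\<^sub>0 / 2) + R * cos (\<alpha>\<^sub>0 / 2) = 0" "\<beta>\<^sub>0 - \<alpha>\<^sub>0 / 2 = - (real n * \<alpha>\<^sub>0 / 2)"
    by (rule minimal_parameters[OF min n], rule that)
  then show "\<exists>\<alpha> \<beta>. S2_type R n \<alpha> \<beta> \<Psi> \<and> - 2 * pi < \<beta> - \<alpha> / 2 \<and> \<beta> - \<alpha> / 2 \<le> 0" by blast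
  fix \<alpha> \<beta>
  show "S2_type R n \<alpha> \<beta> \<Psi> \<and> - 2 * pi < \<beta> - \<alpha> / 2 \<and> \<beta> - \<alpha> / 2 \<le> 0 \<longleftrightarrow>
      cos (real n * \<alpha> / 2) + R * cos (\<alpha> / 2) = 0 \<and>
      0 < \<alpha> \<and> \<alpha> < 2 * pi / real n \<and> \<beta> - \<alpha> / 2 = - (real n * \<alpha> / 2)" (is "?L \<longleftrightarrow> ?Q")
  proof
    assume L: ?L
    \<comment> \<open>The left side does not contain n\<alpha> < 2\<pi>; the bound is inherited from
      \<open>\<alpha>\<^sub>0\<close>, the angle provided by minimality.\<close>
    then have "\<alpha> = \<alpha>\<^sub>0" using S2_type_angle_unique P(1) by blast
    then show ?Q using S2_type_parameters[of R n \<alpha> \<beta> \<Psi>] L P n by auto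
  next
    assume Q: ?Q
    \<comment> \<open>The equations have a single solution, so \<alpha> and \<beta> are the
      parameters that \<Psi> is already known to have.\<close>
    then have "\<alpha> = \<alpha>\<^sub>0" using angle_unique[OF n _ _ _ P(4,5,7)] by blast
    with P(8) Q have "\<beta> = \<beta>\<^sub>0" by simp
    show ?L using P(1-3) unfolding \<open>\<alpha> = \<alpha>\<^sub>0\<close> \<open>\<beta> = \<beta>\<^sub>0\<close> by blast
  qed
qed

end
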